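(* Let $K$ be a field, $n\ge 1$, let $X=(x_{ij})$ be an $n\times n$ matrix that is either generic or generic symmetric, let $Y=(y_1,\dots,y_n)^T$ be a generic column matrix, and let $R$ be the polynomial ring over $K$ in the variables $y_j$ and the entries of $X$. For every $1\le k\le n$, the set $G_k=\bigcup_{i=k}^{n}\widetilde{S}_i$ is a reduced Gröbner basis of the ideal $\widetilde{I}_k$ of $R$ with respect to the lexicographic monomial order induced by $y_1>y_2>\cdots>y_n>x_{ij}$ for all $i,j$, and $x_{ij}>x_{i'j'}$ if $i<i'$, or if $i=i'$ and $j<j'$. In particular, $G_1$ is a reduced Gröbner basis of $\widetilde{I}_1=I_1(XY)$.
   Context: Generic means that the $n^2$ entries of $X$ are independent indeterminates over $K$; generic symmetric means $x_{ij}=x_{ji}$ and the entries $x_{ij}$ with $i\le j$ are independent indeterminates (in this case, in the monomial order each variable is written as $x_{ij}$ with $i\le j$). The $y_j$ are further independent indeterminates. $I_1(XY)$ is the ideal generated by the entries of the $n\times 1$ matrix $XY$. For $1\le k\le n$, $C_k$ is the set of tuples $\mathbf{a}=(a_1,\dots,a_k)$ of integers with $1\le a_1<\cdots<a_k\le n$. $[a_1,\dots,a_k\mid b_1,\dots,b_k]$ denotes the determinant of the submatrix of $X$ with rows $a_1,\dots,a_k$ and columns $b_1,\dots,b_k$. For $\mathbf{a}\in C_k$ put $X^{\mathbf{a},m}=[a_1,\dots,a_k\mid 1,\dots,k-1,m]$ for $k\le m\le n$, and $\widetilde{X^{\mathbf{a}}}=\sum_{m=k}^{n}X^{\mathbf{a},m}y_m$.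 Then $\widetilde{S}_k=\{\widetilde{X^{\mathbf{a}}} : \mathbf{a}\in C_k\}$ and $\widetilde{I}_k$ is the ideal of $R$ generated by $\widetilde{S}_k$. *)

theory Defs
  imports
    "HOL-Library.Poly_Mapping"
    "HOL-Algebra.Ideal"
    "Jordan_Normal_Form.Determinant"
begin

text \<open>
  A monomial is an exponent map \<open>'v \<Rightarrow>\<^sub>0 nat\<close>, a polynomial a finitely supported map from monomials
  to coefficients; \<open>Poly_Mapping\<close> provides the ring operations. The constructors \<open>Yvar j\<close> and
  \<open>Xvar i j\<close> name $y_j$ and $x_{ij}$ with indices counted from 1. As this type has infinitely
  many variables, the polynomial ring in a set of variables is a ring with explicit carrier,
  and ideals are ideals of that ring.
\<close>

type_synonym ('v, 'k) mpoly = "('v \<Rightarrow>\<^sub>0 nat) \<Rightarrow>\<^sub>0 'k"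

definition indet :: "'v \<Rightarrow> ('v, 'k::comm_ring_1) mpoly" where
  "indet v = Poly_Mapping.single (Poly_Mapping.single v 1) 1"

definition poly_ring :: "'v set \<Rightarrow> ('v, 'k::comm_ring_1) mpoly ring" where
  "poly_ring V = \<lparr>carrier = {p. \<forall>m\<in>Poly_Mapping.keys p. Poly_Mapping.keys m \<subseteq> V},
     monoid.mult = (*), one = 1, zero = 0, add = (+)\<rparr>"

lemma poly_ring_cring: "cring (poly_ring V :: ('v, 'k::comm_ring_1) mpoly ring)"
proof -
  let ?R = "poly_ring V :: ('v, 'k) mpoly ring"
  have sel: "monoid.mult ?R = (*)" "one ?R = 1" "zero ?R = 0" "ring.add ?R = (+)"
    by (simp_all add: poly_ring_def)
  have carrier: "p \<in> carrier ?R \<longleftrightarrow>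
      (\<forall>m\<in>Poly_Mapping.keys p. Poly_Mapping.keys m \<subseteq> V)" for p
    by (simp add: poly_ring_def)
  have add: "p + q \<in> carrier ?R" if "p \<in> carrier ?R" "q \<in> carrier ?R" for p q
    using that Poly_Mapping.keys_add[of p q] unfolding carrier by blast
  have mult: "p * q \<in> carrier ?R" if "p \<in> carrier ?R" "q \<in> carrier ?R" for p q
    unfolding carrier
  proof
    fix m assume m: "m \<in> Poly_Mapping.keys (p * q)"
    obtain a b where "m = a + b" "a \<in> Poly_Mapping.keys p" "b \<in> Poly_Mapping.keys q"
      using m keys_mult[of p q] by blast
    then show "Poly_Mapping.keys m \<subseteq> V"
      using that Poly_Mapping.keys_add[of a b] unfolding carrier by blast
  qed
  have minus: "- p \<in> carrier ?R" if "p \<in> carrier ?R" for p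
    using that unfolding carrier by simp
  have zero_one: "0 \<in> carrier ?R" "1 \<in> carrier ?R"
    unfolding carrier by simp_all
  have "abelian_group ?R"
  proof (rule abelian_groupI, unfold sel)
    fix x assume x: "x \<in> carrier ?R"
    show "\<exists>y\<in>carrier ?R. y + x = 0"
      by (rule bexI[OF _ minus[OF x]]) simp
  qed (simp_all only: add zero_one add.assoc add_0_left, rule add.commute)
  moreover have "comm_monoid ?R"
  proof (rule comm_monoidI, unfold sel)
  qed (simp_all only: mult zero_one mult.assoc mult_1_left, rule mult.commute)
  ultimately show ?thesis
    by (rule cringI) (simp only: sel distrib_right)
qed


section \<open>Leading terms and Groebner bases\<close>

text \<open>\<open>lex_less gt\<close> is the lexicographic order on monomials induced by the order
  \<open>gt u v\<close> (\<open>u\<close> is a larger variable than \<open>v\<close>): the largest variable whose exponents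
  differ decides.\<close>

definition lex_less :: "('v \<Rightarrow> 'v \<Rightarrow> bool) \<Rightarrow> ('v \<Rightarrow>\<^sub>0 nat) \<Rightarrow> ('v \<Rightarrow>\<^sub>0 nat) \<Rightarrow> bool" where
  "lex_less gt s t \<longleftrightarrow>
     (\<exists>v. Poly_Mapping.lookup s v < Poly_Mapping.lookup t v \<and>
          (\<forall>u. gt u v \<longrightarrow> Poly_Mapping.lookup s u = Poly_Mapping.lookup t u))"

text \<open>In the following \<open>lt\<close> is a strict monomial order; leading data are only meaningful
  for nonzero polynomials.\<close>

definition lead_monom ::
    "(('v \<Rightarrow>\<^sub>0 nat) \<Rightarrow> ('v \<Rightarrow>\<^sub>0 nat) \<Rightarrow> bool) \<Rightarrow> ('v, 'k::comm_ring_1) mpoly \<Rightarrow> ('v \<Rightarrow>\<^sub>0 nat)" where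
  "lead_monom lt p =
     (THE m. m \<in> Poly_Mapping.keys p \<and>
             (\<forall>m'\<in>Poly_Mapping.keys p. m' \<noteq> m \<longrightarrow> lt m' m))"

definition lead_coef ::
    "(('v \<Rightarrow>\<^sub>0 nat) \<Rightarrow> ('v \<Rightarrow>\<^sub>0 nat) \<Rightarrow> bool) \<Rightarrow> ('v, 'k::comm_ring_1) mpoly \<Rightarrow> 'k" where
  "lead_coef lt p = Poly_Mapping.lookup p (lead_monom lt p)"

definition lead_terms ::
    "(('v \<Rightarrow>\<^sub>0 nat) \<Rightarrow> ('v \<Rightarrow>\<^sub>0 nat) \<Rightarrow> bool) \<Rightarrow> ('v, 'k::comm_ring_1) mpoly set
       \<Rightarrow> ('v, 'k) mpoly set" where
  "lead_terms lt F =
     (\<lambda>f. Poly_Mapping.single (lead_monom lt f) (lead_coef lt f)) ` (F - {0})"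

definition groebner_basis ::
    "('v, 'k::comm_ring_1) mpoly ring \<Rightarrow> (('v \<Rightarrow>\<^sub>0 nat) \<Rightarrow> ('v \<Rightarrow>\<^sub>0 nat) \<Rightarrow> bool)
       \<Rightarrow> ('v, 'k) mpoly set \<Rightarrow> ('v, 'k) mpoly set \<Rightarrow> bool" where
  "groebner_basis R lt I G \<longleftrightarrow>
     ideal I R \<and> finite G \<and> G \<subseteq> I \<and>
     genideal R (lead_terms lt G) = genideal R (lead_terms lt I)"

definition reduced_groebner_basis ::
    "('v, 'k::comm_ring_1) mpoly ring \<Rightarrow> (('v \<Rightarrow>\<^sub>0 nat) \<Rightarrow> ('v \<Rightarrow>\<^sub>0 nat) \<Rightarrow> bool)
       \<Rightarrow> ('v, 'k) mpoly set \<Rightarrow> ('v, 'k) mpoly set \<Rightarrow> bool" where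
  "reduced_groebner_basis R lt I G \<longleftrightarrow>
     groebner_basis R lt I G \<and> 0 \<notin> G \<and>
     (\<forall>g\<in>G. lead_coef lt g = 1 \<and>
        (\<forall>m\<in>Poly_Mapping.keys g.
           Poly_Mapping.single m 1 \<notin> genideal R (lead_terms lt (G - {g}))))"


section \<open>Generic matrices, minors and the sets \<open>S_tilde\<close>\<close>

datatype var = Yvar nat | Xvar nat nat

fun var_gt :: "var \<Rightarrow> var \<Rightarrow> bool" where
  "var_gt (Yvar i) (Yvar j) \<longleftrightarrow> i < j"
| "var_gt (Yvar _) (Xvar _ _) \<longleftrightarrow> True"
| "var_gt (Xvar _ _) (Yvar _) \<longleftrightarrow> False"
| "var_gt (Xvar i j) (Xvar i' j') \<longleftrightarrow> i < i' \<or> i = i' \<and> j < j'"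

datatype matrix_kind = Generic | Generic_Symmetric

fun x_var :: "matrix_kind \<Rightarrow> nat \<Rightarrow> nat \<Rightarrow> var" where
  "x_var Generic i j = Xvar i j"
| "x_var Generic_Symmetric i j = Xvar (min i j) (max i j)"

text \<open>The library's matrix indices start at 0, those of the variables at 1.\<close>

definition X_mat :: "matrix_kind \<Rightarrow> nat \<Rightarrow> (var, 'k::comm_ring_1) mpoly mat" where
  "X_mat \<kappa> n = mat n n (\<lambda>(i, j). indet (x_var \<kappa> (i + 1) (j + 1)))"

definition Y_mat :: "nat \<Rightarrow> (var, 'k::comm_ring_1) mpoly mat" where
  "Y_mat n = mat n 1 (\<lambda>(j, _). indet (Yvar (j + 1)))"

definition R_ring :: "matrix_kind \<Rightarrow> nat \<Rightarrow> (var, 'k::comm_ring_1) mpoly ring" where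
  "R_ring \<kappa> n = poly_ring
     ({Yvar j | j. j \<in> {1..n}} \<union> {x_var \<kappa> i j | i j. i \<in> {1..n} \<and> j \<in> {1..n}})"

text \<open>\<open>minor A a b\<close> is $[a_1,\dots,a_k \mid b_1,\dots,b_k]$, for lists \<open>a\<close>, \<open>b\<close> of indices
  counted from 1.\<close>

definition minor :: "'a::comm_ring_1 mat \<Rightarrow> nat list \<Rightarrow> nat list \<Rightarrow> 'a" where
  "minor A a b = det (mat (length a) (length b) (\<lambda>(i, j). A $$ (a ! i - 1, b ! j - 1)))"

definition C_tuples :: "nat \<Rightarrow> nat \<Rightarrow> nat list set" where
  "C_tuples n k = {a. length a = k \<and> sorted_wrt (<) a \<and> set a \<subseteq> {1..n}}"

definition X_minor :: "matrix_kind \<Rightarrow> nat \<Rightarrow> nat list \<Rightarrow> nat \<Rightarrow> (var, 'k::comm_ring_1) mpoly" where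
  "X_minor \<kappa> n a m = minor (X_mat \<kappa> n) a ([1..<length a] @ [m])"

definition X_tilde :: "matrix_kind \<Rightarrow> nat \<Rightarrow> nat list \<Rightarrow> (var, 'k::comm_ring_1) mpoly" where
  "X_tilde \<kappa> n a = (\<Sum>m = length a..n. X_minor \<kappa> n a m * indet (Yvar m))"

definition S_tilde :: "matrix_kind \<Rightarrow> nat \<Rightarrow> nat \<Rightarrow> (var, 'k::comm_ring_1) mpoly set" where
  "S_tilde \<kappa> n k = X_tilde \<kappa> n ` C_tuples n k"

definition I_tilde :: "matrix_kind \<Rightarrow> nat \<Rightarrow> nat \<Rightarrow> (var, 'k::comm_ring_1) mpoly set" where
  "I_tilde \<kappa> n k = genideal (R_ring \<kappa> n) (S_tilde \<kappa> n k)"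

definition I1_XY :: "matrix_kind \<Rightarrow> nat \<Rightarrow> (var, 'k::comm_ring_1) mpoly set" where
  "I1_XY \<kappa> n = genideal (R_ring \<kappa> n) (elements_mat (X_mat \<kappa> n * Y_mat n))"

definition G_set :: "matrix_kind \<Rightarrow> nat \<Rightarrow> nat \<Rightarrow> (var, 'k::comm_ring_1) mpoly set" where
  "G_set \<kappa> n k = (\<Union>i\<in>{k..n}. S_tilde \<kappa> n i)"

end

theory Submission
  imports Defs
begin

text \<open>
  Write $Z = XY$ and let $X_j$ be the $j$-th column of $X$. As the terms with $m < k$ in the
  following determinant have a repeated column, \<open>X_tilde a\<close> is, for a tuple \<open>a\<close> of length $k$,
  the determinant of the rows \<open>a\<close> of the matrix with columns $X_1,\dots,X_{k-1},Z$. Its leading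
  monomial is $y_k$ times the diagonal product $\prod_i x_{a_i,i}$. The only property of $X$ used
  for this, and for everything below except reducedness, is that the variables decrease strictly
  along the rows and along the columns of the matrix (\<open>variable_matrix\<close>); then among the monomials
  obtained by pairing a strictly increasing list of rows with the rearrangements of a list of
  columns, the sorted pairing is the largest one (\<open>pair_monomial_less_sort\<close>).

  The Groebner property is Buchberger's criterion in the following form: whenever the leading
  monomials of two generators divide a monomial $m$, the difference of the multiples of these
  generators with leading monomial $m$ is a combination of multiples of generators with smaller
  leading monomials; the two generators are then called linked at $m$. Being linked is an
  equivalence relation, so that only few pairs have to be treated directly. Two determinant
  identities suffice.

  First, expanding the determinant with rows $b_1 < \dots < b_{l+1}$ and columns
  $X_1,\dots,X_{l-1},Z,X_j$, where $j \le l$, along its last column gives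
  $\sum_i \pm x_{b_i,j}\, \tilde X^{b \setminus b_i}$. The determinant is $0$ for $j < l$ and
  $-\tilde X^b$ for $j = l$, and this has a smaller leading monomial because of
  $y_{l+1} < y_l$. In the sum exactly the terms $i = j$ and $i = j+1$ share the largest leading
  monomial. So two tuples which differ only in their $j$-th entry are linked
  (\<open>exchange_linked\<close>). If the leading monomials of two tuples of the same length divide $m$, one
  can make them equal by repeatedly replacing, at the first position where they differ, the
  larger entry by the smaller one, and each tuple on the way still has a leading monomial dividing
  $m$ (\<open>linked_same_length\<close>).

  Secondly, for $h < l$ and a tuple $b$ of length $l$, the determinant with columns
  $X_1,\dots,X_{h-1},Z,X_{h+1},\dots,X_{l-1},Z$ vanishes. Writing the last $Z$ as
  $\sum_m y_m X_m$ expresses $y_h \tilde X^b$ through determinants which, expanded along their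
  last $l-h$ columns, are combinations of the $\tilde X^S$ with $S \subset b$ of length $h$.
  The largest term belongs to the prefix of $b$, so $b$ and its prefix of length $h$ are linked
  (\<open>prefix_linked\<close>). Together this links all pairs.

  The first identity for $j = l$ also shows that the longer generators lie in the ideal of the
  shortest ones. Reducedness is a count: a leading monomial dividing a monomial of \<open>X_tilde a\<close>
  must have the same $y$-variable and then the same degree, and the number of occurrences
  of each index as row or column of an $x$-variable recovers the tuple
  (\<open>divisible_only_by_own_leading_monomial\<close>).
\<close>

section \<open>Standard representations and Buchberger's criterion\<close>

abbreviation "lookup \<equiv> Poly_Mapping.lookup"
abbreviation "keys \<equiv> Poly_Mapping.keys"
abbreviation "single \<equiv> Poly_Mapping.single"

text \<open>The type class order on exponent maps is lexicographic with the smallest variable as the most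
  significant one. So a variable that is larger in the monomial order has to be smaller in the
  type class order on variables.\<close>
lemma monomial_less_iff:
  fixes s t :: "'v::linorder \<Rightarrow>\<^sub>0 nat"
  shows "s < t \<longleftrightarrow> (\<exists>v. lookup s v < lookup t v \<and> (\<forall>u<v. lookup s u = lookup t u))"
  by (simp add: less_poly_mapping.rep_eq less_fun_def)

lemma keys_add_monomial: "keys (s + t) = keys s \<union> keys (t :: 'v \<Rightarrow>\<^sub>0 nat)"
  by (auto simp: in_keys_iff lookup_add)

lemma monomial_diff_add:
  fixes s t :: "'v \<Rightarrow>\<^sub>0 nat"
  assumes "\<And>v. lookup s v \<le> lookup t v"
  shows "t - s + s = t"
  using assms by (intro poly_mapping_eqI) (simp add: lookup_add lookup_minus)

text \<open>With infinitely many variables the lexicographic order is not well-founded; restricting the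
  exponents to a finite set of variables makes it so. Induction removes the most significant
  variable: a least element is found among the monomials with the least exponent there.\<close>
lemma monomial_set_has_least:
  fixes A :: "('v::linorder \<Rightarrow>\<^sub>0 nat) set"
  assumes "finite W" "A \<noteq> {}" "\<And>s. s \<in> A \<Longrightarrow> keys s \<subseteq> W"
  shows "\<exists>m\<in>A. \<forall>s\<in>A. m \<le> s"
  using assms
proof (induction W arbitrary: A rule: finite_linorder_min_induct)
  case empty
  then have "A = {0}" by fastforce
  then show ?case by simp
next
  case (insert b W)
  define e where "e = (LEAST e. \<exists>s\<in>A. lookup s b = e)"
  have e_attained: "\<exists>s\<in>A. lookup s b = e"
    unfolding e_def by (rule LeastI_ex) (use insert.prems(1) in auto)
  have e_le: "e \<le> lookup s b" if "s \<in> A" for s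
    unfolding e_def by (rule Least_le) (use that in auto)
  define A' where "A' = {s \<in> A. lookup s b = e}"
  define B where "B = (\<lambda>s. s - single b e) ` A'"
  have restore: "s - single b e + single b e = s" if "s \<in> A" for s
    by (rule monomial_diff_add) (use e_le[OF that] in \<open>auto simp: lookup_single when_def\<close>)
  have "keys s \<subseteq> W" if s: "s \<in> B" for s
  proof
    fix v assume v: "v \<in> keys s"
    obtain t where t: "t \<in> A" "lookup t b = e" "s = t - single b e"
      using s by (auto simp: B_def A'_def)
    have "v \<noteq> b" using v t by (auto simp: in_keys_iff lookup_minus)
    moreover have "v \<in> keys t" using v t by (auto simp: in_keys_iff lookup_minus)
    ultimately show "v \<in> W" using insert.prems(2)[OF t(1)] by auto
  qed
  moreover have "B \<noteq> {}" using e_attained by (auto simp: B_def A'_def)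
  ultimately obtain m0 where m0: "m0 \<in> B" "\<forall>s\<in>B. m0 \<le> s" using insert.IH by blast
  then obtain m where m: "m \<in> A" "lookup m b = e" "m0 = m - single b e"
    by (auto simp: B_def A'_def)
  have "m \<le> s" if s: "s \<in> A" for s
  proof (cases "lookup s b = e")
    case True
    then have "m0 \<le> s - single b e" using m0 s by (auto simp: B_def A'_def)
    then have "m0 + single b e \<le> s - single b e + single b e" by (rule add_right_mono)
    then show ?thesis using restore m s by simp
  next
    case False
    then have "lookup m b < lookup s b" using e_le[OF s] m by simp
    moreover have "lookup m u = lookup s u" if "u < b" for u
    proof -
      have "u \<notin> insert b W" using that insert.hyps by auto
      then have "u \<notin> keys m" "u \<notin> keys s" using insert.prems(2) m(1) s by blast+
      then show ?thesis by (simp add: in_keys_iff)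
    qed
    ultimately have "m < s" unfolding monomial_less_iff by blast
    then show ?thesis by simp
  qed
  then show ?case using m by blast
qed

lemma poly_eq_sum_monomials: "p = (\<Sum>t\<in>keys p. single t (lookup p t))"
proof (rule poly_mapping_eqI)
  fix u
  have "lookup (\<Sum>t\<in>keys p. single t (lookup p t)) u
      = (\<Sum>t\<in>keys p. if t = u then lookup p u else 0)"
    by (auto simp: lookup_sum lookup_single when_def intro!: sum.cong)
  also have "\<dots> = lookup p u" by (auto simp: in_keys_iff)
  finally show "lookup p u = lookup (\<Sum>t\<in>keys p. single t (lookup p t)) u" by simp
qed

lemma lookup_monomial_mult:
  fixes p :: "('v, 'k::comm_ring_1) mpoly"
  shows "lookup (single s c * p) (s + t) = c * lookup p t"
proof -
  have "single s c * p = (\<Sum>u\<in>keys p. single (s + u) (c * lookup p u))"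
    by (subst poly_eq_sum_monomials[of p]) (simp add: sum_distrib_left mult_single)
  then have "lookup (single s c * p) (s + t) = (\<Sum>u\<in>keys p. if u = t then c * lookup p t else 0)"
    by (auto simp: lookup_sum lookup_single when_def intro!: sum.cong)
  also have "\<dots> = c * lookup p t" by (auto simp: in_keys_iff)
  finally show ?thesis .
qed

lemma keys_monomial_mult:
  "keys (single s c * p) \<subseteq> (+) s ` keys (p :: ('v, 'k::comm_ring_1) mpoly)"
  using keys_mult[of "single s c" p] by (auto split: if_splits)

locale monic_family =
  fixes W :: "'v::linorder set" and T :: "'i set"
    and g :: "'i \<Rightarrow> ('v, 'k::comm_ring_1) mpoly" and lm :: "'i \<Rightarrow> 'v \<Rightarrow>\<^sub>0 nat"
  assumes finite_vars: "finite W" and finite_index: "finite T"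
    and lookup_lm: "a \<in> T \<Longrightarrow> lookup (g a) (lm a) = 1"
    and le_lm: "a \<in> T \<Longrightarrow> s \<in> keys (g a) \<Longrightarrow> s \<le> lm a"
    and vars_lm: "a \<in> T \<Longrightarrow> keys (lm a) \<subseteq> W"
begin

text \<open>A standard representation in which every contributing multiple of a generator has a leading
  monomial below \<open>m\<close>. The cofactors are restricted to the finite set \<open>W\<close> of variables, since
  termination relies on the well-foundedness of the monomials in \<open>W\<close>.\<close>
definition below :: "('v \<Rightarrow>\<^sub>0 nat) \<Rightarrow> ('v, 'k) mpoly \<Rightarrow> bool" where
  "below m p \<longleftrightarrow> (\<exists>h. p = (\<Sum>a\<in>T. h a * g a) \<and>
     (\<forall>a\<in>T. \<forall>t\<in>keys (h a). keys t \<subseteq> W \<and> t + lm a < m))"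

lemma below_zero: "below m 0"
  unfolding below_def by (rule exI[of _ "\<lambda>_. 0"]) simp

lemma below_add:
  assumes "below m p" "below m q"
  shows "below m (p + q)"
proof -
  obtain h where h: "p = (\<Sum>a\<in>T. h a * g a)"
      "\<And>a t. a \<in> T \<Longrightarrow> t \<in> keys (h a) \<Longrightarrow> keys t \<subseteq> W \<and> t + lm a < m"
    using assms(1) unfolding below_def by blast
  obtain h' where h': "q = (\<Sum>a\<in>T. h' a * g a)"
      "\<And>a t. a \<in> T \<Longrightarrow> t \<in> keys (h' a) \<Longrightarrow> keys t \<subseteq> W \<and> t + lm a < m"
    using assms(2) unfolding below_def by blast
  show ?thesis unfolding below_def
  proof (rule exI[of _ "\<lambda>a. h a + h' a"], intro conjI ballI)
    show "p + q = (\<Sum>a\<in>T. (h a + h' a) * g a)"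
      by (simp add: h(1) h'(1) sum.distrib distrib_right)
    fix a t assume "a \<in> T" "t \<in> keys (h a + h' a)"
    then show "keys t \<subseteq> W" "t + lm a < m"
      using h(2) h'(2) Poly_Mapping.keys_add[of "h a" "h' a"] by blast+
  qed
qed

lemma below_monomial_mult:
  assumes "below m p" "keys u \<subseteq> W"
  shows "below (u + m) (single u c * p)"
proof -
  obtain h where h: "p = (\<Sum>a\<in>T. h a * g a)"
      "\<And>a t. a \<in> T \<Longrightarrow> t \<in> keys (h a) \<Longrightarrow> keys t \<subseteq> W \<and> t + lm a < m"
    using assms(1) unfolding below_def by blast
  show ?thesis unfolding below_def
  proof (rule exI[of _ "\<lambda>a. single u c * h a"], intro conjI ballI)
    show "single u c * p = (\<Sum>a\<in>T. single u c * h a * g a)"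
      by (simp add: h(1) sum_distrib_left mult.assoc)
    fix a t assume "a \<in> T" "t \<in> keys (single u c * h a)"
    then obtain s where s: "t = u + s" "s \<in> keys (h a)"
      using keys_monomial_mult[of u c "h a"] by blast
    show "keys t \<subseteq> W" "t + lm a < u + m"
      using h(2)[OF \<open>a \<in> T\<close> s(2)] assms(2) s(1)
      by (auto simp: keys_add_monomial add.assoc)
  qed
qed

lemma below_uminus: "below m p \<Longrightarrow> below m (- p)"
  using below_monomial_mult[of m p 0 "- 1"] by (simp add: single_uminus)

lemma below_diff: "below m p \<Longrightarrow> below m q \<Longrightarrow> below m (p - q)"
  using below_add[OF _ below_uminus, of m p q] by simp

lemma below_sum: "(\<And>i. i \<in> A \<Longrightarrow> below m (f i)) \<Longrightarrow> below m (sum f A)"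
  by (induction A rule: infinite_finite_induct) (auto intro: below_add below_zero)

lemma below_generator:
  assumes "a \<in> T" "keys t \<subseteq> W" "t + lm a < m"
  shows "below m (single t c * g a)"
  unfolding below_def
proof (rule exI[of _ "\<lambda>b. if b = a then single t c else 0"], intro conjI ballI)
  have "(\<Sum>b\<in>T. (if b = a then single t c else 0) * g b)
      = (\<Sum>b\<in>T. if b = a then single t c * g a else 0)" by (intro sum.cong) auto
  then show "single t c * g a = (\<Sum>b\<in>T. (if b = a then single t c else 0) * g b)"
    using assms(1) finite_index by simp
  fix b s assume "b \<in> T" "s \<in> keys (if b = a then single t c else 0)"
  then show "keys s \<subseteq> W" "s + lm b < m" using assms by (auto split: if_splits)
qed

text \<open>The condition of Buchberger's criterion at \<open>m\<close>. The subtraction of exponents is truncated, so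
  the definition is only meaningful when both leading monomials divide \<open>m\<close>; leaving this condition
  to the users makes the relation transitive without side conditions.\<close>
definition linked :: "('v \<Rightarrow>\<^sub>0 nat) \<Rightarrow> 'i \<Rightarrow> 'i \<Rightarrow> bool" where
  "linked m a b \<longleftrightarrow> below m (single (m - lm a) 1 * g a - single (m - lm b) 1 * g b)"

lemma linked_refl: "linked m a a"
  by (simp add: linked_def below_zero)

lemma linked_sym: "linked m a b \<Longrightarrow> linked m b a"
  unfolding linked_def using below_uminus by force

lemma linked_trans: "linked m a b \<Longrightarrow> linked m b c \<Longrightarrow> linked m a c"
  unfolding linked_def
  using below_add[of m "single (m - lm a) 1 * g a - single (m - lm b) 1 * g b"
      "single (m - lm b) 1 * g b - single (m - lm c) 1 * g c"] by simp

lemma linkedI: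
  assumes "t + lm a = m" "s + lm b = m" "keys u \<subseteq> W"
    and "below m (single t 1 * g a - single s 1 * g b)"
  shows "linked (u + m) a b"
proof -
  have "u + m - lm a = u + t" "u + m - lm b = u + s"
    using assms(1,2) by (metis add.assoc add_diff_cancel_right')+
  moreover have "below (u + m) (single u 1 * (single t 1 * g a - single s 1 * g b))"
    using below_monomial_mult[OF assms(4,3)] .
  ultimately show ?thesis
    by (simp add: linked_def right_diff_distrib mult_single flip: mult.assoc)
qed

lemma lookup_below_eq_zero:
  assumes "below m p"
  shows "lookup p m = 0"
proof -
  obtain h where h: "p = (\<Sum>a\<in>T. h a * g a)"
      "\<And>a t. a \<in> T \<Longrightarrow> t \<in> keys (h a) \<Longrightarrow> keys t \<subseteq> W \<and> t + lm a < m"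
    using assms unfolding below_def by blast
  have "m \<notin> keys (h a * g a)" if a: "a \<in> T" for a
  proof
    assume "m \<in> keys (h a * g a)"
    then obtain t s where "m = t + s" "t \<in> keys (h a)" "s \<in> keys (g a)"
      using keys_mult[of "h a" "g a"] by blast
    then show False using h(2)[OF a] le_lm[OF a]
      by (metis add_left_mono leD)
  qed
  then show ?thesis by (simp add: h(1) lookup_sum in_keys_iff)
qed

text \<open>Among all representations of \<open>f\<close> take one whose largest leading monomial \<open>m\<close> of a summand is
  as small as possible. If \<open>m\<close> did not occur in \<open>f\<close>, the coefficients with which the generators
  reach \<open>m\<close> would add up to zero, so the part of the representation that reaches \<open>m\<close> would be a
  combination of differences of linked multiples, and could be replaced by smaller summands.\<close>
theorem leading_monomial_divisible:
  assumes linked: "\<And>m a b. \<lbrakk>a \<in> T; b \<in> T; keys m \<subseteq> W; \<exists>t. m = t + lm a; \<exists>t. m = t + lm b\<rbrakk>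
      \<Longrightarrow> linked m a b"
    and f: "f = (\<Sum>a\<in>T. h a * g a)" "\<And>a t. a \<in> T \<Longrightarrow> t \<in> keys (h a) \<Longrightarrow> keys t \<subseteq> W"
    and "f \<noteq> 0"
  shows "\<exists>a\<in>T. \<exists>t. keys t \<subseteq> W \<and> t + lm a \<in> keys f \<and> (\<forall>s\<in>keys f. s \<le> t + lm a)"
proof -
  define upto where "upto m h \<longleftrightarrow> f = (\<Sum>a\<in>T. h a * g a) \<and>
     (\<forall>a\<in>T. \<forall>t\<in>keys (h a). keys t \<subseteq> W \<and> t + lm a \<le> m)" for m h
  define A where "A = {m. keys m \<subseteq> W \<and> (\<exists>h. upto m h)}"
  have improve: "\<exists>m\<in>A. \<exists>a\<in>T. \<exists>t\<in>keys (h a). m = t + lm a"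
    if h: "f = (\<Sum>a\<in>T. h a * g a)" "\<And>a t. a \<in> T \<Longrightarrow> t \<in> keys (h a) \<Longrightarrow> keys t \<subseteq> W" for h
  proof -
    define M where "M = (\<Union>a\<in>T. (\<lambda>t. t + lm a) ` keys (h a))"
    have "finite M" using finite_index by (simp add: M_def)
    have "M \<noteq> {}"
    proof
      assume "M = {}"
      then have "h a = 0" if "a \<in> T" for a using that by (auto simp: M_def)
      then show False using \<open>f \<noteq> 0\<close> h(1) by simp
    qed
    have "Max M \<in> M" using \<open>finite M\<close> \<open>M \<noteq> {}\<close> by simp
    then obtain a t where at: "a \<in> T" "t \<in> keys (h a)" "Max M = t + lm a"
      by (auto simp: M_def)
    have "t + lm a \<le> Max M" if "a \<in> T" "t \<in> keys (h a)" for a t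
      using \<open>finite M\<close> that by (intro Max_ge) (auto simp: M_def)
    then have "upto (Max M) h" using h by (simp add: upto_def)
    moreover have "keys (Max M) \<subseteq> W"
      using at h(2) vars_lm by (simp add: keys_add_monomial)
    ultimately show ?thesis using at by (auto simp: A_def)
  qed
  have "A \<noteq> {}" using improve[OF f] by auto
  moreover have "keys s \<subseteq> W" if "s \<in> A" for s using that by (simp add: A_def)
  ultimately obtain m where m: "m \<in> A" "\<forall>s\<in>A. m \<le> s"
    using monomial_set_has_least[OF finite_vars, of A] by blast
  then obtain h where h: "upto m h" by (auto simp: A_def)
  have le_m: "s \<le> m" if "s \<in> keys f" for s
  proof -
    have "s \<in> (\<Union>a\<in>T. keys (h a * g a))"
      using that keys_sum[of "\<lambda>a. h a * g a" T] h by (auto simp: upto_def)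
    then obtain a t u where "a \<in> T" "s = t + u" "t \<in> keys (h a)" "u \<in> keys (g a)"
      using keys_mult by blast
    then show ?thesis using h le_lm[of a u] unfolding upto_def
      by (meson add_left_mono order_trans)
  qed
  \<comment> \<open>the part of the representation that reaches the bound \<open>m\<close>\<close>
  define T0 where "T0 = {a \<in> T. \<exists>t. m = t + lm a}"
  define c where "c a = (if a \<in> T0 then lookup (h a) (m - lm a) else 0)" for a
  define h' where "h' a = h a - single (m - lm a) (c a)" for a
  have h'_below: "keys t \<subseteq> W \<and> t + lm a < m" if "a \<in> T" "t \<in> keys (h' a)" for a t
  proof -
    have t: "t \<in> keys (h a)"
      using that(2) by (auto simp: h'_def c_def in_keys_iff lookup_minus lookup_single when_def
          split: if_splits)
    have "t + lm a \<noteq> m"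
    proof
      assume *: "t + lm a = m"
      then have "m - lm a = t" by (metis add_diff_cancel_right')
      moreover have "a \<in> T0" using * that by (auto simp: T0_def)
      ultimately show False using that(2) by (simp add: h'_def c_def in_keys_iff lookup_minus)
    qed
    then show ?thesis using h t \<open>a \<in> T\<close> by (auto simp: upto_def less_le)
  qed
  define r where "r = (\<Sum>a\<in>T. h' a * g a)"
  define e where "e a = single (m - lm a) 1 * g a" for a
  have r: "below m r" unfolding below_def r_def using h'_below by blast
  have "f = r + (\<Sum>a\<in>T. single 0 (c a) * e a)"
  proof -
    have "h a * g a = h' a * g a + single 0 (c a) * e a" for a
      by (simp add: h'_def e_def algebra_simps mult_single flip: mult.assoc)
    then show ?thesis using h by (simp add: upto_def r_def sum.distrib)
  qed
  also have "(\<Sum>a\<in>T. single 0 (c a) * e a) = (\<Sum>a\<in>T0. single 0 (c a) * e a)"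
    using finite_index by (intro sum.mono_neutral_right) (auto simp: T0_def c_def)
  finally have f_split: "f = r + (\<Sum>a\<in>T0. single 0 (c a) * e a)" .
  have T0: "m - lm a + lm a = m" "a \<in> T" if "a \<in> T0" for a
    using that by (auto simp: T0_def)
  have "lookup (e a) m = 1" if a: "a \<in> T0" for a
    using lookup_monomial_mult[of "m - lm a" 1 "g a" "lm a"] T0[OF a] lookup_lm
    by (simp add: e_def)
  then have "lookup (single 0 (c a) * e a) m = c a" if "a \<in> T0" for a
    using lookup_monomial_mult[of 0 "c a" "e a" m] that by simp
  then have coeff: "lookup f m = (\<Sum>a\<in>T0. c a)"
    using lookup_below_eq_zero[OF r] by (simp add: f_split lookup_add lookup_sum)
  have "lookup f m \<noteq> 0"
  proof
    assume *: "lookup f m = 0"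
    have "below m (\<Sum>a\<in>T0. single 0 (c a) * e a)"
    proof (cases "T0 = {}")
      case True
      then show ?thesis by (simp add: below_zero)
    next
      case False
      then obtain b where b: "b \<in> T0" by blast
      have "(\<Sum>a\<in>T0. single 0 (c a) * e b) = single 0 (\<Sum>a\<in>T0. c a) * e b"
      proof -
        have "single 0 (\<Sum>a\<in>A. c a) = (\<Sum>a\<in>A. single 0 (c a) :: ('v, 'k) mpoly)" for A
          by (induction A rule: infinite_finite_induct) (simp_all add: single_add)
        then show ?thesis by (simp add: sum_distrib_right)
      qed
      then have "(\<Sum>a\<in>T0. single 0 (c a) * e b) = 0"
        using * coeff by simp
      then have "(\<Sum>a\<in>T0. single 0 (c a) * e a) = (\<Sum>a\<in>T0. single 0 (c a) * (e a - e b))"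
        by (simp add: right_diff_distrib sum_subtractf)
      moreover have "below m (e a - e b)" if "a \<in> T0" for a
        using linked[of a b m] that b m(1) by (auto simp: T0_def A_def linked_def e_def)
      then have "below m (single 0 (c a) * (e a - e b))" if "a \<in> T0" for a
        using below_monomial_mult[of m "e a - e b" 0 "c a"] that by simp
      ultimately show ?thesis by (simp add: below_sum)
    qed
    then have "below m f" using r by (simp add: f_split below_add)
    then obtain h'' where h'': "f = (\<Sum>a\<in>T. h'' a * g a)"
        "\<And>a t. a \<in> T \<Longrightarrow> t \<in> keys (h'' a) \<Longrightarrow> keys t \<subseteq> W \<and> t + lm a < m"
      unfolding below_def by blast
    then obtain m' where "m' \<in> A" "m' < m" using improve[of h''] by blast
    then show False using m(2) by auto
  qed
  then have "(\<Sum>a\<in>T0. c a) \<noteq> 0" using coeff by simp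
  then obtain a where a: "a \<in> T0" by (meson sum.neutral)
  have "keys (m - lm a) \<subseteq> keys (m - lm a + lm a)" by (simp add: keys_add_monomial)
  then have "keys (m - lm a) \<subseteq> W" using T0(1)[OF a] m(1) by (auto simp: A_def)
  then show ?thesis
    using T0[OF a] \<open>lookup f m \<noteq> 0\<close> le_m by (intro bexI[of _ a] exI[of _ "m - lm a"])
      (simp_all add: in_keys_iff)
qed

end

section \<open>Monomials that pair rows with columns\<close>

definition pair_monomial :: "(nat \<Rightarrow> nat \<Rightarrow> 'v) \<Rightarrow> nat list \<Rightarrow> nat list \<Rightarrow> 'v \<Rightarrow>\<^sub>0 nat" where
  "pair_monomial x b c = (\<Sum>(p, r)\<leftarrow>zip b c. single (x p r) 1)"

abbreviation drop_nth :: "nat \<Rightarrow> 'a list \<Rightarrow> 'a list" where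
  "drop_nth i b \<equiv> take i b @ drop (Suc i) b"

lemma pair_monomial_Nil [simp]: "pair_monomial x [] c = 0" "pair_monomial x b [] = 0"
  by (simp_all add: pair_monomial_def)

lemma pair_monomial_Cons [simp]:
  "pair_monomial x (p # b) (r # c) = single (x p r) 1 + pair_monomial x b c"
  by (simp add: pair_monomial_def)

lemma pair_monomial_append:
  "length b = length c \<Longrightarrow>
     pair_monomial x (b @ b') (c @ c') = pair_monomial x b c + pair_monomial x b' c'"
  by (simp add: pair_monomial_def)

lemma pair_monomial_transpose: "pair_monomial x b c = pair_monomial (\<lambda>r p. x p r) c b"
proof (induction b arbitrary: c)
  case (Cons p b)
  then show ?case by (cases c) simp_all
qed simp

lemma keys_pair_monomial: "keys (pair_monomial x b c) = (\<lambda>(p, r). x p r) ` set (zip b c)"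
proof (induction b arbitrary: c)
  case (Cons p b)
  then show ?case by (cases c) (simp_all add: keys_add_monomial)
qed simp

lemma lookup_pair_monomial_eq_0:
  assumes "\<And>p r. (p, r) \<in> set (zip b c) \<Longrightarrow> x p r \<noteq> v"
  shows "lookup (pair_monomial x b c) v = 0"
proof -
  have "v \<notin> keys (pair_monomial x b c)"
    using assms unfolding keys_pair_monomial by auto
  then show ?thesis by (simp add: in_keys_iff)
qed

text \<open>Matching row \<open>b ! i\<close> with column \<open>j\<close> and the remaining rows in order with \<open>c\<close> amounts to
  inserting \<open>j\<close> into \<open>c\<close> at position \<open>i\<close>. This describes the monomials in an expansion along a
  column.\<close>
lemma pair_monomial_insert:
  assumes "i < length b" "length b = Suc (length c)"
  shows "single (x (b ! i) j) 1 + pair_monomial x (drop_nth i b) c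
       = pair_monomial x b (take i c @ j # drop i c)"
proof -
  have b: "b = take i b @ b ! i # drop (Suc i) b" using assms(1) by (rule id_take_nth_drop)
  have "pair_monomial x (drop_nth i b) c
      = pair_monomial x (drop_nth i b) (take i c @ drop i c)" by simp
  also have "\<dots> = pair_monomial x (take i b) (take i c) + pair_monomial x (drop (Suc i) b) (drop i c)"
    using assms by (intro pair_monomial_append) simp
  finally have "single (x (b ! i) j) 1 + pair_monomial x (drop_nth i b) c
      = pair_monomial x (take i b @ b ! i # drop (Suc i) b) (take i c @ j # drop i c)"
    using assms by (subst pair_monomial_append) (simp_all add: ac_simps)
  then show ?thesis using b by simp
qed

text \<open>As smaller means more significant, the locale assumptions say that in the monomial order the
  entries decrease along rows and columns and that the \<open>y\<close>-variables dominate. Distinct positions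
  may hold the same variable, which covers the symmetric matrix.\<close>
locale variable_matrix =
  fixes x :: "nat \<Rightarrow> nat \<Rightarrow> 'v::linorder" and y :: "nat \<Rightarrow> 'v"
  assumes x_row: "r < s \<Longrightarrow> x p r < x p s"
    and x_col: "p < q \<Longrightarrow> x p r < x q r"
    and y_less: "i < j \<Longrightarrow> y i < y j"
    and y_x: "y i < x p r"
begin

lemma x_strict: "p < q \<Longrightarrow> r \<le> s \<Longrightarrow> x p r < x q s"
  using x_row[of r s p] x_col[of p q s] by (cases "r = s") auto

text \<open>If the first row is not paired with the smallest column \<open>s\<close>, then every variable of the unsorted
  pairing is less significant than \<open>x p s\<close>, where \<open>p\<close> is the first row, whereas the sorted pairing
  contains \<open>x p s\<close>. Otherwise the first pair can be cancelled.\<close>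
lemma pair_monomial_less_sort:
  assumes "sorted_wrt (<) b" "length b = length c" "\<not> sorted c"
  shows "pair_monomial x b c < pair_monomial x b (sort c)"
  using assms
proof (induction b arbitrary: c)
  case Nil
  then show ?case by simp
next
  case (Cons p b c0)
  then obtain r c where c0: "c0 = r # c" by (cases c0) auto
  have below_b: "p < q" if "q \<in> set b" for q using Cons.prems that by auto
  show ?case
  proof (cases "\<forall>t\<in>set c. r \<le> t")
    case True
    then have "sort c0 = r # sort c" by (simp add: c0 insort_is_Cons)
    moreover have "\<not> sorted c" using True Cons.prems c0 by auto
    ultimately show ?thesis using Cons c0 by (simp add: add_strict_left_mono)
  next
    case False
    then obtain t0 where t0: "t0 \<in> set c" "t0 < r" by auto
    obtain s d where d: "sort c0 = s # d" using c0 by (cases "sort c0") (auto simp: sort_key_simps)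
    have s_le: "s \<le> t" if "t \<in> set c0" for t
    proof -
      have "sorted (s # d)" "t \<in> set (s # d)" using that d
        by (metis sorted_sort, metis set_sort)
      then show ?thesis by auto
    qed
    have "s < r" using t0 s_le[of t0] c0 by auto
    have greater: "x p s < x q t" if "(q, t) \<in> set (zip (p # b) c0)" for q t
    proof -
      have "t \<in> set c0" using that by (rule set_zip_rightD)
      have "q = p \<and> t = r \<or> q \<in> set b" using that c0 by (auto dest: set_zip_leftD)
      then show ?thesis
        using x_row[OF \<open>s < r\<close>] x_strict[OF below_b s_le[OF \<open>t \<in> set c0\<close>]] by auto
    qed
    have greater_eq: "x p s \<le> x q t" if "(q, t) \<in> set (zip (p # b) (s # d))" for q t
    proof -
      have "t \<in> set (sort c0)" using that d by (metis set_zip_rightD)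
      then have "s \<le> t" using s_le by simp
      have "q = p \<and> t = s \<or> q \<in> set b" using that by (auto dest: set_zip_leftD)
      then show ?thesis
        using x_strict[OF below_b \<open>s \<le> t\<close>] by (auto intro: less_imp_le)
    qed
    have "lookup (pair_monomial x (p # b) c0) u = 0" if "u \<le> x p s" for u
      using greater that by (intro lookup_pair_monomial_eq_0) fastforce
    moreover have "lookup (pair_monomial x (p # b) (s # d)) u = 0" if "u < x p s" for u
      using greater_eq that by (intro lookup_pair_monomial_eq_0) fastforce
    moreover have "0 < lookup (pair_monomial x (p # b) (s # d)) (x p s)"
      by (simp add: lookup_add)
    ultimately show ?thesis unfolding monomial_less_iff d
      by (intro exI[of _ "x p s"]) auto
  qed
qed

lemma pair_monomial_less_cols:
  assumes "sorted_wrt (<) b" "sorted C" "mset c = mset C" "length b = length C" "c \<noteq> C"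
  shows "pair_monomial x b c < pair_monomial x b C"
proof -
  have "sort c = C" by (rule properties_for_sort) (use assms in auto)
  have "\<not> sorted c" using \<open>sort c = C\<close> assms(5) by (auto dest: sorted_sort_id)
  have "length b = length c" using assms by (metis size_mset)
  show ?thesis
    using pair_monomial_less_sort[OF assms(1) \<open>length b = length c\<close> \<open>\<not> sorted c\<close>] \<open>sort c = C\<close> by simp
qed

lemma transpose_variable_matrix: "variable_matrix (\<lambda>r p. x p r) y"
  by unfold_locales (auto intro: x_row x_col y_less y_x)

lemma pair_monomial_less_rows:
  assumes "sorted_wrt (<) C" "sorted B" "mset b = mset B" "length B = length C" "b \<noteq> B"
  shows "pair_monomial x b C < pair_monomial x B C"
  unfolding pair_monomial_transpose[of x _ C]
  using variable_matrix.pair_monomial_less_cols[OF transpose_variable_matrix, of C B b] assms by simp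

lemma lookup_y_pair_monomial [simp]: "lookup (pair_monomial x b c) (y i) = 0"
  using y_x by (intro lookup_pair_monomial_eq_0) (metis less_irrefl)

lemma y_monomial_less:
  assumes "i < j"
  shows "single (y j) 1 + pair_monomial x b c < single (y i) 1 + pair_monomial x b' c'"
  unfolding monomial_less_iff
proof (rule exI[of _ "y i"], intro conjI allI impI)
  show "lookup (single (y j) 1 + pair_monomial x b c) (y i)
      < lookup (single (y i) 1 + pair_monomial x b' c') (y i)"
    using y_less[OF assms] by (simp add: lookup_add lookup_single)
  fix u assume u: "u < y i"
  have "lookup (pair_monomial x b c) u = 0" for b c
    using u y_x by (intro lookup_pair_monomial_eq_0) (metis less_asym)
  then show "lookup (single (y j) 1 + pair_monomial x b c) u
      = lookup (single (y i) 1 + pair_monomial x b' c') u"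
    using u y_less[OF assms] by (auto simp add: lookup_add lookup_single when_def)
qed

end

section \<open>Determinants given by a list of columns\<close>

definition cols_det :: "nat list \<Rightarrow> (nat \<Rightarrow> 'a::comm_ring_1) list \<Rightarrow> 'a" where
  "cols_det b cs = det (mat (length b) (length cs) (\<lambda>(i, j). (cs ! j) (b ! i)))"

lemma cols_det_snoc:
  assumes "length b = Suc (length cs)"
  shows "cols_det b (cs @ [c]) =
    (\<Sum>i<length b. (- 1) ^ (i + length cs) * c (b ! i) * cols_det (drop_nth i b) cs)"
proof -
  let ?n = "length b" and ?A = "mat (length b) (length (cs @ [c])) (\<lambda>(i, j). ((cs @ [c]) ! j) (b ! i))"
  have "?A \<in> carrier_mat ?n ?n" using assms by auto
  then have "cols_det b (cs @ [c]) = (\<Sum>i<?n. ?A $$ (i, length cs) * cofactor ?A i (length cs))"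
    unfolding cols_det_def by (rule laplace_expansion_column) (simp add: assms)
  also have "\<dots> = (\<Sum>i<?n. (- 1) ^ (i + length cs) * c (b ! i) * cols_det (drop_nth i b) cs)"
  proof (rule sum.cong[OF refl])
    fix i assume "i \<in> {..<?n}"
    then have i: "i < ?n" by simp
    have "mat_delete ?A i (length cs)
        = mat (length (drop_nth i b)) (length cs) (\<lambda>(i', j). (cs ! j) (drop_nth i b ! i'))"
      using i assms by (intro eq_matI) (auto simp: mat_delete_def nth_append min_def)
    then show "?A $$ (i, length cs) * cofactor ?A i (length cs)
        = (- 1) ^ (i + length cs) * c (b ! i) * cols_det (drop_nth i b) cs"
      using i by (simp add: cofactor_def cols_det_def ac_simps)
  qed
  finally show ?thesis .
qed

text \<open>In both of the following rules one of the two columns is the last one; this is the only case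
  that occurs, and it leaves just one position to be named.\<close>
lemma cols_det_repeated_column:
  assumes "length b = length A + length B + 2"
  shows "cols_det b (A @ c # B @ [c]) = 0"
  unfolding cols_det_def
  by (rule det_identical_columns[of _ "length b" "length A" "length A + length B + 1"])
    (use assms in \<open>auto simp: nth_append\<close>)

lemma cols_det_swap_columns:
  assumes "length b = length A + length B + 2"
  shows "cols_det b (A @ d # B @ [c]) = - cols_det b (A @ c # B @ [d])"
proof -
  let ?cs = "A @ c # B @ [d]" and ?l = "length A + length B + 1"
  let ?A = "mat (length b) (length ?cs) (\<lambda>(i, j). (?cs ! j) (b ! i))"
  have swap: "(A @ d # B @ [c]) ! j = ?cs ! (if j = length A then ?l else if j = ?l then length A else j)"
    if "j < length b" for j
    using that assms by (auto simp: nth_append nth_Cons')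
  have "mat (length b) (length (A @ d # B @ [c])) (\<lambda>(i, j). ((A @ d # B @ [c]) ! j) (b ! i))
      = swapcols (length A) ?l ?A"
    by (rule eq_matI) (use assms in \<open>auto simp: swap simp del: append.simps\<close>)
  then show ?thesis unfolding cols_det_def
    using det_swapcols[of "length A" "length b" ?l ?A] assms by simp
qed

lemma cols_det_last_column_sum:
  assumes "length b = Suc (length cs)"
  shows "cols_det b (cs @ [\<lambda>p. \<Sum>m\<in>M. f m p * z m]) = (\<Sum>m\<in>M. z m * cols_det b (cs @ [f m]))"
proof -
  have "(\<Sum>m\<in>M. z m * cols_det b (cs @ [f m])) = (\<Sum>m\<in>M. \<Sum>i<length b.
      z m * ((- 1) ^ (i + length cs) * f m (b ! i) * cols_det (drop_nth i b) cs))"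
    by (simp add: cols_det_snoc[OF assms] sum_distrib_left)
  also have "\<dots> = (\<Sum>i<length b. \<Sum>m\<in>M.
      z m * ((- 1) ^ (i + length cs) * f m (b ! i) * cols_det (drop_nth i b) cs))"
    by (rule sum.swap)
  also have "\<dots> = cols_det b (cs @ [\<lambda>p. \<Sum>m\<in>M. f m p * z m])"
    by (simp add: cols_det_snoc[OF assms] sum_distrib_left sum_distrib_right ac_simps)
  finally show ?thesis by simp
qed

section \<open>The generators and their leading monomials\<close>

lemma upt_split: "i \<le> m \<Longrightarrow> m < j \<Longrightarrow> [i..<j] = [i..<m] @ m # [Suc m..<j]"
  by (metis upt_conv_Cons upt_add_eq_append le_add_diff_inverse less_imp_le)

lemma in_keys_sumE:
  assumes "s \<in> keys (sum f A)"
  obtains i where "i \<in> A" "s \<in> keys (f i)"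
  using assms subsetD[OF keys_sum[of f A]] by auto

lemma prod_monomials:
  "(\<Prod>i\<in>A. single (s i) 1 :: ('v, 'k::comm_ring_1) mpoly) = single (\<Sum>i\<in>A. s i) 1"
  by (induction A rule: infinite_finite_induct) (simp_all add: mult_single)

lemma sign_monomial: "(- 1) ^ e * single s c = (single s ((- 1) ^ e * c) :: ('v, 'k::comm_ring_1) mpoly)"
  by (cases "even e") (simp_all add: single_uminus)

lemma pair_monomial_sum:
  assumes "length b = length c"
  shows "pair_monomial x b c = (\<Sum>i = 0..<length b. single (x (b ! i) (c ! i)) 1)"
  using assms unfolding pair_monomial_def by (simp add: sum_list_sum_nth)

lemma sorted_drop_nth:
  assumes "sorted_wrt (<) (b :: nat list)" "i < length b"
  shows "sorted_wrt (<) (drop_nth i b)"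
proof -
  have "sorted_wrt (<) (take i b @ b ! i # drop (Suc i) b)"
    using assms by (simp flip: id_take_nth_drop)
  then show ?thesis by (auto simp: sorted_wrt_append)
qed

lemma set_drop_nth: "set (drop_nth i b) \<subseteq> set b"
  using set_take_subset[of i b] set_drop_subset[of "Suc i" b] by auto

lemma mset_drop_nth:
  assumes "i < length b"
  shows "mset b = add_mset (b ! i) (mset (drop_nth i b))"
proof -
  have "mset b = mset (take i b @ b ! i # drop (Suc i) b)"
    using assms by (simp only: id_take_nth_drop[symmetric])
  then show ?thesis by simp
qed

text \<open>The parameter \<open>K\<close> fixes the ring of coefficients, which no other parameter mentions.\<close>
locale variable_matrix_ideal = variable_matrix x y
  for x :: "nat \<Rightarrow> nat \<Rightarrow> 'v::linorder" and y :: "nat \<Rightarrow> 'v" +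
  fixes n k :: nat and K :: "'k::comm_ring_1 itself"
  assumes k_pos: "1 \<le> k"
begin

definition W :: "'v set" where
  "W = y ` {1..n} \<union> (\<lambda>(i, j). x i j) ` ({1..n} \<times> {1..n})"

text \<open>The index set of the family $G_k$: the generators of $\tilde I_k$ belong to its shortest tuples.\<close>
definition T :: "nat list set" where
  "T = {a. sorted_wrt (<) a \<and> set a \<subseteq> {1..n} \<and> k \<le> length a}"

definition X_col :: "nat \<Rightarrow> nat \<Rightarrow> ('v, 'k) mpoly" where
  "X_col m p = indet (x p m)"

definition XY_col :: "nat \<Rightarrow> ('v, 'k) mpoly" where
  "XY_col p = (\<Sum>m = 1..n. X_col m p * indet (y m))"

definition tilde_cols :: "nat \<Rightarrow> (nat \<Rightarrow> ('v, 'k) mpoly) list" where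
  "tilde_cols l = map X_col [1..<l] @ [XY_col]"

text \<open>The polynomial \<open>X_tilde a\<close> as a single determinant. It includes the terms of $XY$ that vanish
  because of a repeated column, and it is in this form that column operations apply.\<close>
definition gen :: "nat list \<Rightarrow> ('v, 'k) mpoly" where
  "gen a = cols_det a (tilde_cols (length a))"

definition lm :: "nat list \<Rightarrow> 'v \<Rightarrow>\<^sub>0 nat" where
  "lm a = single (y (length a)) 1 + pair_monomial x a [1..<Suc (length a)]"

lemma length_tilde_cols: "1 \<le> l \<Longrightarrow> length (tilde_cols l) = l"
  by (simp add: tilde_cols_def)

lemma length_le_n:
  assumes "sorted_wrt (<) a" "set a \<subseteq> {1..n}"
  shows "length a \<le> n"
proof -
  have "distinct a" using assms(1) by (simp add: strict_sorted_iff)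
  then have "length a = card (set a)" by (simp add: distinct_card)
  also have "\<dots> \<le> n" using card_mono[OF _ assms(2)] by simp
  finally show ?thesis .
qed

lemma finite_T: "finite T"
proof (rule finite_subset)
  show "T \<subseteq> {a. set a \<subseteq> {1..n} \<and> length a \<le> n}" using length_le_n by (auto simp: T_def)
  show "finite {a. set a \<subseteq> {1..n} \<and> length a \<le> n}" by (rule finite_lists_length_le) simp
qed

lemma finite_W: "finite W"
  by (simp add: W_def)

lemma keys_pair_monomial_W:
  assumes "set b \<subseteq> {1..n}" "set c \<subseteq> {1..n}"
  shows "keys (pair_monomial x b c) \<subseteq> W"
proof -
  have "set (zip b c) \<subseteq> {1..n} \<times> {1..n}"
    using assms by (auto dest: set_zip_leftD set_zip_rightD)
  then show ?thesis unfolding keys_pair_monomial W_def by blast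
qed

lemma keys_lm_W:
  assumes "a \<in> T"
  shows "keys (lm a) \<subseteq> W"
proof -
  have "length a \<le> n" "1 \<le> length a" "set a \<subseteq> {1..n}"
    using assms length_le_n k_pos by (auto simp: T_def)
  moreover from this have "keys (pair_monomial x a [1..<Suc (length a)]) \<subseteq> W"
    by (intro keys_pair_monomial_W) auto
  ultimately have "keys (pair_monomial x a [1..<Suc (length a)]) \<subseteq> W" "y (length a) \<in> W"
    by (simp_all add: W_def)
  then show ?thesis by (simp add: lm_def keys_add_monomial)
qed

lemma cols_det_variables:
  assumes "length a = length C"
  shows "cols_det a (map X_col C) = (\<Sum>p | p permutes {0..<length a}.
     single (pair_monomial x a (permute_list p C)) (signof p))"
proof -
  let ?l = "length a"
  have "cols_det a (map X_col C) = (\<Sum>p | p permutes {0..<?l}.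
      signof p * (\<Prod>i = 0..<?l. indet (x (a ! i) (C ! p i))))"
    unfolding cols_det_def
    using permutes_in_image[of _ "{0..<?l}"]
    by (subst det_def'[of _ ?l]) (use assms in \<open>auto simp: X_col_def intro!: sum.cong prod.cong\<close>)
  also have "\<dots> = (\<Sum>p | p permutes {0..<?l}.
      single (pair_monomial x a (permute_list p C)) (signof p))"
  proof (rule sum.cong[OF refl])
    fix p assume "p \<in> {p. p permutes {0..<?l}}"
    then have "(\<Prod>i = 0..<?l. indet (x (a ! i) (C ! p i)))
        = (single (pair_monomial x a (permute_list p C)) 1 :: ('v, 'k) mpoly)"
      using assms by (auto simp: indet_def prod_monomials pair_monomial_sum permute_list_nth
          atLeast0LessThan)
    then show "signof p * (\<Prod>i = 0..<?l. indet (x (a ! i) (C ! p i)))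
        = (single (pair_monomial x a (permute_list p C)) (signof p) :: ('v, 'k) mpoly)"
      by (simp add: sign_def single_uminus)
  qed
  finally show ?thesis .
qed

lemma keys_cols_det_variables:
  assumes "length a = length C" "s \<in> keys (cols_det a (map X_col C))"
  shows "\<exists>c. mset c = mset C \<and> s = pair_monomial x a c"
proof -
  obtain p where "p permutes {0..<length a}"
      "s \<in> keys (single (pair_monomial x a (permute_list p C)) (signof p) :: ('v, 'k) mpoly)"
    using assms(2) unfolding cols_det_variables[OF assms(1)] by (auto elim: in_keys_sumE)
  then have p: "p permutes {0..<length a}" "s = pair_monomial x a (permute_list p C)"
    by (auto split: if_splits)
  then have "mset (permute_list p C) = mset C" using assms(1) by (simp add: atLeast0LessThan)
  then show ?thesis using p(2) by blast
qed

text \<open>Only the identity permutation contributes to the diagonal monomial, even when the matrix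
  has repeated variables, because every other pairing gives a strictly smaller monomial.\<close>
lemma lookup_cols_det_variables:
  assumes "length a = length C" "sorted_wrt (<) a" "sorted_wrt (<) C"
  shows "lookup (cols_det a (map X_col C)) (pair_monomial x a C) = 1"
proof -
  let ?P = "{p. p permutes {0..<length a}}"
  have "lookup (single (pair_monomial x a (permute_list p C)) (signof p) :: ('v, 'k) mpoly)
      (pair_monomial x a C) = (if p = id then 1 else 0)" if p: "p \<in> ?P" for p
  proof (cases "p = id")
    case True
    then show ?thesis by simp
  next
    case False
    then obtain i where i: "p i \<noteq> i" by (auto simp: fun_eq_iff)
    then have i_less: "i < length C" using p assms(1) by (auto simp: permutes_def)
    then have "p i < length C" using p assms(1) permutes_in_image[of p "{0..<length C}" i]
      by simp
    moreover have "distinct C" "sorted C" using assms(3) by (auto simp: strict_sorted_iff)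
    ultimately have "C ! p i \<noteq> C ! i" using i i_less by (simp add: nth_eq_iff_index_eq)
    moreover have perm: "p permutes {..<length C}" using p assms(1) by (simp add: atLeast0LessThan)
    ultimately have "permute_list p C \<noteq> C"
      using permute_list_nth[OF perm i_less] by auto
    then have "pair_monomial x a (permute_list p C) < pair_monomial x a C"
      using assms \<open>sorted C\<close> perm by (intro pair_monomial_less_cols) auto
    then show ?thesis using False by (simp add: lookup_single)
  qed
  then have "lookup (cols_det a (map X_col C)) (pair_monomial x a C)
      = (\<Sum>p\<in>?P. if p = id then 1 else 0)"
    by (simp add: cols_det_variables[OF assms(1)] lookup_sum)
  also have "\<dots> = 1"
    by (subst sum.delta) (auto simp: finite_permutations permutes_id)
  finally show ?thesis .
qed

lemma gen_expand:
  assumes "1 \<le> length a"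
  shows "gen a = (\<Sum>m = length a..n. indet (y m) * cols_det a (map X_col ([1..<length a] @ [m])))"
proof -
  let ?l = "length a" and ?D = "\<lambda>m. cols_det a (map X_col ([1..<length a] @ [m]))"
  have "gen a = (\<Sum>m = 1..n. indet (y m) * ?D m)"
    using cols_det_last_column_sum[of a "map X_col [1..<?l]" X_col "\<lambda>m. indet (y m)" "{1..n}"] assms
    by (simp add: gen_def tilde_cols_def XY_col_def[abs_def])
  also have "\<dots> = (\<Sum>m = ?l..n. indet (y m) * ?D m)"
  proof (rule sum.mono_neutral_right)
    show "\<forall>m\<in>{1..n} - {?l..n}. indet (y m) * ?D m = 0"
    proof
      fix m assume "m \<in> {1..n} - {?l..n}"
      then have m: "1 \<le> m" "m < ?l" by auto
      have "?D m = 0"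
        using cols_det_repeated_column[of a "map X_col [1..<m]" "map X_col [Suc m..<?l]" "X_col m"] m
        unfolding upt_split[OF m] by simp
      then show "indet (y m) * ?D m = 0" by simp
    qed
  qed (use assms in auto)
  finally show ?thesis .
qed

lemma keys_gen:
  assumes "1 \<le> length a" "s \<in> keys (gen a)"
  shows "\<exists>m c. length a \<le> m \<and> m \<le> n \<and> mset c = mset ([1..<length a] @ [m])
      \<and> s = single (y m) 1 + pair_monomial x a c"
proof -
  obtain m where m: "m \<in> {length a..n}"
      "s \<in> keys (indet (y m) * cols_det a (map X_col ([1..<length a] @ [m])))"
    using assms(2) unfolding gen_expand[OF assms(1)] by (rule in_keys_sumE)
  obtain t where t: "s = single (y m) 1 + t" "t \<in> keys (cols_det a (map X_col ([1..<length a] @ [m])))"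
    using subsetD[OF keys_monomial_mult] m(2) unfolding indet_def by blast
  have len: "length a = length ([1..<length a] @ [m])" using assms(1) by auto
  obtain c where "mset c = mset ([1..<length a] @ [m])" "t = pair_monomial x a c"
    using keys_cols_det_variables[OF len t(2)] by blast
  then show ?thesis using m(1) t(1) by auto
qed

lemma keys_gen_W:
  assumes "a \<in> T" "s \<in> keys (gen a)"
  shows "keys s \<subseteq> W"
proof -
  have a: "1 \<le> length a" "set a \<subseteq> {1..n}" "length a \<le> n"
    using assms(1) k_pos length_le_n by (auto simp: T_def)
  obtain m c where m: "length a \<le> m" "m \<le> n" "mset c = mset ([1..<length a] @ [m])"
      "s = single (y m) 1 + pair_monomial x a c"
    using keys_gen[OF a(1) assms(2)] by blast
  have "set c \<subseteq> {1..n}" using mset_eq_setD[OF m(3)] m a by auto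
  then have "keys (pair_monomial x a c) \<subseteq> W" by (rule keys_pair_monomial_W[OF a(2)])
  moreover have "y m \<in> W" using m a by (simp add: W_def)
  ultimately show ?thesis by (simp add: m(4) keys_add_monomial)
qed

lemma gen_singleton: "gen [p] = XY_col p"
  unfolding gen_def cols_det_def by (subst det_single) (simp_all add: tilde_cols_def)

lemma keys_gen_le:
  assumes "a \<in> T" "s \<in> keys (gen a)"
  shows "s \<le> lm a"
proof -
  have a: "1 \<le> length a" "sorted_wrt (<) a" using assms(1) k_pos by (auto simp: T_def)
  obtain m c where s: "length a \<le> m" "mset c = mset ([1..<length a] @ [m])"
      "s = single (y m) 1 + pair_monomial x a c"
    using keys_gen[OF a(1) assms(2)] by auto
  show ?thesis
  proof (cases "m = length a")
    case True
    have "mset c = mset [1..<Suc (length a)]" using s(2) True a(1) by simp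
    then have "pair_monomial x a c < pair_monomial x a [1..<Suc (length a)]"
      if "c \<noteq> [1..<Suc (length a)]"
      using that a(2) by (intro pair_monomial_less_cols) (simp_all del: upt_Suc)
    then have "pair_monomial x a c \<le> pair_monomial x a [1..<Suc (length a)]"
      by (cases "c = [1..<Suc (length a)]") (auto intro: less_imp_le simp del: upt_Suc)
    then show ?thesis using s(3) True by (simp add: lm_def add_left_mono)
  next
    case False
    then show ?thesis using y_monomial_less[of "length a" m] s by (simp add: lm_def less_imp_le)
  qed
qed

lemma lookup_gen_lm:
  assumes "a \<in> T"
  shows "lookup (gen a) (lm a) = 1"
proof -
  let ?l = "length a" and ?f = "\<lambda>m. indet (y m) * cols_det a (map X_col ([1..<length a] @ [m]))"
  have a: "1 \<le> ?l" "sorted_wrt (<) a" "?l \<le> n"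
    using assms(1) k_pos length_le_n by (auto simp: T_def)
  have "lookup (?f m) (lm a) = 0" if "m \<in> {Suc ?l..n}" for m
  proof -
    have "s < lm a" if s: "s \<in> keys (?f m)" for s
    proof -
      obtain t where t: "s = single (y m) 1 + t" "t \<in> keys (cols_det a (map X_col ([1..<length a] @ [m])))"
        using subsetD[OF keys_monomial_mult] s unfolding indet_def by blast
      have "length a = length ([1..<length a] @ [m])" using a(1) by auto
      then obtain c where "t = pair_monomial x a c"
        using keys_cols_det_variables[OF _ t(2)] by blast
      then show ?thesis using y_monomial_less[of "length a" m] \<open>m \<in> _\<close> t(1) by (simp add: lm_def)
    qed
    then have "lm a \<notin> keys (?f m)" by blast
    then show ?thesis by (simp add: in_keys_iff)
  qed
  moreover have "lookup (?f ?l) (lm a) = 1"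
  proof -
    have "[1..<?l] @ [?l] = [1..<Suc ?l]" using a(1) by simp
    then show ?thesis
      using lookup_cols_det_variables[of a "[1..<Suc ?l]"] a(2)
      unfolding lm_def indet_def lookup_monomial_mult by (simp del: upt_Suc)
  qed
  moreover have "{?l..n} = insert ?l {Suc ?l..n}" using a(3) by auto
  ultimately show ?thesis by (simp add: gen_expand[OF a(1)] lookup_sum lookup_add)
qed

sublocale monic_family W T gen lm
  by unfold_locales (simp_all add: finite_W finite_T lookup_gen_lm keys_gen_le keys_lm_W)

lemma below_sign: "below m p \<Longrightarrow> below m ((- 1) ^ e * p)"
  by (cases "even e") (auto intro: below_uminus)

lemma drop_nth_in_T:
  assumes "sorted_wrt (<) b" "set b \<subseteq> {1..n}" "length b = Suc l" "k \<le> l" "i < length b"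
  shows "drop_nth i b \<in> T" "length (drop_nth i b) = l"
proof -
  show "length (drop_nth i b) = l" using assms by auto
  then show "drop_nth i b \<in> T"
    using assms sorted_drop_nth[OF assms(1,5)] set_drop_nth[of i b]
    unfolding T_def by auto
qed

section \<open>Tuples that differ in one entry\<close>

text \<open>Both sides evaluate the determinant with columns $X_1,\dots,X_{l-1},Z,X_j$: on the left it is
  expanded along its last column, on the right there is a repeated column, or an interchange of
  the last two columns leads to the generator of \<open>b\<close>.\<close>
lemma exchange_relation:
  assumes "length b = Suc l" "1 \<le> j" "j \<le> l"
  shows "(\<Sum>i<Suc l. (- 1) ^ (i + l) * indet (x (b ! i) j) * gen (drop_nth i b))
    = (if j = l then - gen b else 0)"
proof -
  have "(\<Sum>i<Suc l. (- 1) ^ (i + l) * indet (x (b ! i) j) * gen (drop_nth i b))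
      = cols_det b (tilde_cols l @ [X_col j])"
    using assms by (subst cols_det_snoc) (auto simp: length_tilde_cols X_col_def gen_def min_def intro!: sum.cong)
  also have "\<dots> = (if j = l then - gen b else 0)"
  proof (cases "j = l")
    case True
    then show ?thesis
      using cols_det_swap_columns[of b "map X_col [1..<l]" "[]" XY_col "X_col l"] assms
      by (simp add: tilde_cols_def gen_def)
  next
    case False
    then have j: "1 \<le> j" "j < l" using assms by auto
    then show ?thesis
      using cols_det_repeated_column[of b "map X_col [1..<j]" "map X_col [Suc j..<l] @ [XY_col]" "X_col j"] assms(1) j
      unfolding tilde_cols_def upt_split[OF j] by simp
  qed
  finally show ?thesis .
qed

lemma in_T_iff: "a \<in> T \<longleftrightarrow> sorted_wrt (<) a \<and> set a \<subseteq> {1..n} \<and> k \<le> length a"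
  by (simp add: T_def)

text \<open>The \<open>i\<close>-th term of the exchange relation has the leading monomial that pairs \<open>b\<close> with the
  list $1,\dots,l$ into which \<open>j\<close> has been inserted at position \<open>i\<close>. This list is sorted for
  exactly two values of \<open>i\<close>, whose terms carry opposite signs and hence form the difference sought.
  The factor \<open>u\<close> transports the statement to multiples.\<close>
lemma exchange_linked:
  assumes b: "sorted_wrt (<) b" "set b \<subseteq> {1..n}" "length b = Suc l" and l: "k \<le> l"
    and j: "1 \<le> j" "j \<le> l" and u: "keys u \<subseteq> W"
  shows "linked (u + (single (x (b ! j) j) 1 + lm (drop_nth j b))) (drop_nth j b) (drop_nth (j - 1) b)"
    and "single (x (b ! j) j) 1 + lm (drop_nth j b)
       = single (x (b ! (j - 1)) j) 1 + lm (drop_nth (j - 1) b)"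
proof -
  define L where "L = [1..<Suc l]"
  define ins where "ins i = take i L @ j # drop i L" for i
  define C where "C = [1..<Suc j] @ [j..<Suc l]"
  have len_L: "length L = l" by (simp add: L_def)
  have len: "length (drop_nth i b) = l" if "i < Suc l" for i
    using drop_nth_in_T(2)[OF b l] that b(3) by simp
  have in_T: "drop_nth i b \<in> T" if "i < Suc l" for i
    using drop_nth_in_T(1)[OF b l] that b(3) by simp
  have mono: "single (x (b ! i) j) 1 + lm (drop_nth i b) = single (y l) 1 + pair_monomial x b (ins i)"
    if "i < Suc l" for i
    using pair_monomial_insert[of i b L x j] that b(3) len_L len[OF that]
    by (simp add: lm_def ins_def L_def ac_simps del: upt_Suc)
  have nth_C: "C ! i = (if i < j then Suc i else i)" if "i < Suc l" for i
    using that j by (auto simp: C_def nth_append simp del: upt_Suc)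
  have ins_C: "ins j = C" "ins (j - 1) = C"
  proof -
    have "L = [1..<Suc j] @ [Suc j..<Suc l]" "[j..<Suc l] = j # [Suc j..<Suc l]"
      using j upt_add_eq_append[of 1 "Suc j" "l - j"] upt_conv_Cons[of j "Suc l"] by (simp_all add: L_def del: upt_Suc)
    then show "ins j = C" by (simp add: ins_def C_def del: upt_Suc)
    have "L = [1..<j] @ [j..<Suc l]" "[1..<Suc j] = [1..<j] @ [j]"
      using j upt_add_eq_append[of 1 "j" "Suc l - j"] by (simp_all add: L_def del: upt_Suc) (simp add: upt_Suc)
    then show "ins (j - 1) = C" by (simp add: ins_def C_def del: upt_Suc)
  qed
  have mset_ins: "mset (ins i) = add_mset j (mset L)" for i
  proof -
    have "mset (ins i) = add_mset j (mset (take i L) + mset (drop i L))" by (simp add: ins_def)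
    also have "mset (take i L) + mset (drop i L) = mset L"
      by (simp only: append_take_drop_id flip: mset_append)
    finally show ?thesis .
  qed
  have "sorted C" by (auto simp: C_def sorted_append simp del: upt_Suc)
  have "length C = Suc l" using j by (simp add: C_def)
  define m0 where "m0 = single (y l) 1 + pair_monomial x b C"
  have smaller: "single (x (b ! i) j) 1 + lm (drop_nth i b) < m0"
    if "i < Suc l" "i \<noteq> j" "i \<noteq> j - 1" for i
  proof -
    have "ins i ! i = j" using that len_L by (simp add: ins_def nth_append)
    moreover have "C ! i \<noteq> j" using nth_C[OF that(1)] that(2,3) by (simp split: if_split) linarith
    ultimately have "ins i \<noteq> C" by metis
    then have "pair_monomial x b (ins i) < pair_monomial x b C"
      using b \<open>sorted C\<close> \<open>length C = Suc l\<close> mset_ins[of i] mset_ins[of j] ins_C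
      by (intro pair_monomial_less_cols) auto
    then show ?thesis using mono[OF that(1)] by (simp add: m0_def add_strict_left_mono)
  qed
  have m0: "single (x (b ! j) j) 1 + lm (drop_nth j b) = m0"
    "single (x (b ! (j - 1)) j) 1 + lm (drop_nth (j - 1) b) = m0"
    using mono[of j] mono[of "j - 1"] j ins_C by (simp_all add: m0_def)
  then show "single (x (b ! j) j) 1 + lm (drop_nth j b)
       = single (x (b ! (j - 1)) j) 1 + lm (drop_nth (j - 1) b)" by simp
  have in_W: "x (b ! i) j \<in> W" if "i < Suc l" for i
  proof -
    have "b ! i \<in> {1..n}" using that b by (metis nth_mem subsetD)
    moreover have "j \<in> {1..n}" using j b length_le_n[OF b(1,2)] by simp
    ultimately show ?thesis by (auto simp: W_def)
  qed
  define f where "f i = (- 1) ^ (i + l) * indet (x (b ! i) j) * gen (drop_nth i b)" for i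
  have rest: "below m0 (f i)" if "i \<in> {..<Suc l} - {j - 1, j}" for i
  proof -
    have "below m0 (single (single (x (b ! i) j) 1) 1 * gen (drop_nth i b))"
      using that in_T[of i] in_W[of i] smaller[of i] by (intro below_generator) auto
    then show ?thesis unfolding f_def indet_def mult.assoc by (rule below_sign)
  qed
  have "below m0 (if j = l then - gen b else 0)"
  proof (cases "j = l")
    case True
    have "b \<in> T" using b l by (simp add: in_T_iff)
    moreover have "0 + lm b < m0"
      using y_monomial_less[of l "Suc l"] by (simp add: m0_def lm_def b(3) del: upt_Suc)
    ultimately have "below m0 (single 0 1 * gen b)" by (intro below_generator) auto
    then show ?thesis using True below_uminus by simp
  qed (simp add: below_zero)
  moreover have "(\<Sum>i<Suc l. f i) = (if j = l then - gen b else 0)"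
    unfolding f_def by (rule exchange_relation[OF b(3) j])
  ultimately have total: "below m0 (\<Sum>i<Suc l. f i)" by (simp only:)
  have "(\<Sum>i<Suc l. f i) = (\<Sum>i\<in>{..<Suc l} - {j - 1, j}. f i) + (\<Sum>i\<in>{j - 1, j}. f i)"
    by (rule sum.subset_diff) (use j in auto)
  then have "f j + f (j - 1) = (\<Sum>i<Suc l. f i) - (\<Sum>i\<in>{..<Suc l} - {j - 1, j}. f i)"
    using j by (simp del: sum.lessThan_Suc)
  then have "below m0 (f j + f (j - 1))"
    using below_diff[OF total below_sum[OF rest]] by (simp only:)
  then have "below m0 ((- 1) ^ (j + l) * (f j + f (j - 1)))" by (rule below_sign)
  moreover have "(- 1) ^ (j + l) * (f j + f (j - 1))
      = single (single (x (b ! j) j) 1) 1 * gen (drop_nth j b)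
      - single (single (x (b ! (j - 1)) j) 1) 1 * gen (drop_nth (j - 1) b)"
  proof -
    obtain i where "j = Suc i" using j(1) by (cases j) auto
    then show ?thesis by (simp add: f_def indet_def algebra_simps flip: power_add mult_2)
  qed
  ultimately show "linked (u + (single (x (b ! j) j) 1 + lm (drop_nth j b))) (drop_nth j b) (drop_nth (j - 1) b)"
    unfolding m0(1) using m0 u by (intro linkedI) simp_all
qed

section \<open>A tuple and its prefixes\<close>

lemma column_monomial_mult:
  assumes "length r = length C"
  shows "X_col c p * (single (pair_monomial x r C) d * q)
    = single (pair_monomial x (r @ [p]) (C @ [c])) d * q"
proof -
  have "X_col c p * single (pair_monomial x r C) d = single (pair_monomial x (r @ [p]) (C @ [c])) d"
    using assms by (simp add: X_col_def indet_def pair_monomial_append mult_single add.commute)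
  then show ?thesis by (simp only: flip: mult.assoc)
qed

lemma signed_column_monomial_mult:
  assumes "length r = length C"
  shows "(- 1) ^ e * X_col c p * (single (pair_monomial x r C) d * q)
    = single (pair_monomial x (r @ [p]) (C @ [c])) ((- 1) ^ e * d) * q"
  unfolding mult.assoc column_monomial_mult[OF assms] sign_monomial[symmetric] ..

text \<open>An iterated expansion along the columns of variables at the end, in place of Laplace's
  expansion along several columns: it has summands that are single monomials times minors, one for
  each way \<open>r\<close> of assigning rows to these columns, with \<open>S\<close> the rows left over. Since the
  summands only need to be estimated, the result is stated as membership in an arbitrary set
  closed under addition; in the induction this set is replaced by its quotient by a signed variable.\<close>
lemma cols_det_tail:
  fixes V :: "('v, 'k) mpoly set" and B :: "(nat \<Rightarrow> ('v, 'k) mpoly) list"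
  assumes "0 \<in> V" "\<And>p q. p \<in> V \<Longrightarrow> q \<in> V \<Longrightarrow> p + q \<in> V"
    and "sorted_wrt (<) b" "length b = length B + length C"
    and "\<And>S r c. sorted_wrt (<) S \<Longrightarrow> length S = length B \<Longrightarrow> mset (S @ r) = mset b \<Longrightarrow>
      single (pair_monomial x r C) c * cols_det S B \<in> V"
  shows "cols_det b (B @ map X_col C) \<in> V"
  using assms
proof (induction C arbitrary: b V rule: rev_induct)
  case Nil
  then show ?case using Nil.prems(5)[of b "[]" 1] by simp
next
  case (snoc c C)
  have sum_in: "sum f A \<in> V" if "\<And>i. i \<in> A \<Longrightarrow> f i \<in> V" for f :: "nat \<Rightarrow> _" and A
    using that snoc.prems(1,2) by (induction A rule: infinite_finite_induct) auto
  have "cols_det b (B @ map X_col (C @ [c])) = cols_det b ((B @ map X_col C) @ [X_col c])" by simp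
  also have "\<dots> = (\<Sum>i<length b. (- 1) ^ (i + length (B @ map X_col C)) * X_col c (b ! i)
      * cols_det (drop_nth i b) (B @ map X_col C))"
    by (rule cols_det_snoc) (use snoc.prems(4) in simp)
  also have "\<dots> \<in> V"
  proof (rule sum_in)
    fix i assume "i \<in> {..<length b}"
    then have i: "i < length b" by simp
    define e where "e = i + length (B @ map X_col C)"
    define V' where "V' = {p. (- 1) ^ e * X_col c (b ! i) * p \<in> V}"
    have "cols_det (drop_nth i b) (B @ map X_col C) \<in> V'"
    proof (rule snoc.IH)
      show "p + q \<in> V'" if "p \<in> V'" "q \<in> V'" for p q
        using that snoc.prems(1,2) by (simp_all add: V'_def distrib_left)
      show "0 \<in> V'" using snoc.prems(1) by (simp add: V'_def)
      show "sorted_wrt (<) (drop_nth i b)" using snoc.prems(3) i by (rule sorted_drop_nth)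
      show "length (drop_nth i b) = length B + length C" using snoc.prems(4) i by simp
      fix S r d
      assume S: "sorted_wrt (<) S" "length S = length B" "mset (S @ r) = mset (drop_nth i b)"
      have mset: "mset (S @ (r @ [b ! i])) = mset b" using mset_drop_nth[OF i] S(3) by simp
      then have "length (S @ r @ [b ! i]) = length b" by (metis size_mset)
      then have "length r = length C" using S(2) snoc.prems(4) by simp
      then have "(- 1) ^ e * X_col c (b ! i) * (single (pair_monomial x r C) d * cols_det S B)
          = single (pair_monomial x (r @ [b ! i]) (C @ [c])) ((- 1) ^ e * d) * cols_det S B"
        by (rule signed_column_monomial_mult)
      also have "\<dots> \<in> V" using S(1,2) mset by (rule snoc.prems(5))
      finally show "single (pair_monomial x r C) d * cols_det S B \<in> V'" by (simp add: V'_def)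
    qed
    then show "(- 1) ^ (i + length (B @ map X_col C)) * X_col c (b ! i)
        * cols_det (drop_nth i b) (B @ map X_col C) \<in> V" by (simp add: V'_def e_def)
  qed
  finally show ?case .
qed

text \<open>The assignment of the last rows in order to the columns at the end occurs once, with sign \<open>+\<close>,
  and is split off.\<close>
lemma cols_det_tail_leading:
  fixes V :: "('v, 'k) mpoly set" and B :: "(nat \<Rightarrow> ('v, 'k) mpoly) list"
  assumes "0 \<in> V" "\<And>p q. p \<in> V \<Longrightarrow> q \<in> V \<Longrightarrow> p + q \<in> V"
    and "sorted_wrt (<) b" "length b = length B + length C"
    and "\<And>S r c. sorted_wrt (<) S \<Longrightarrow> length S = length B \<Longrightarrow> mset (S @ r) = mset b \<Longrightarrow>
      S @ r \<noteq> b \<Longrightarrow> single (pair_monomial x r C) c * cols_det S B \<in> V"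
  shows "cols_det b (B @ map X_col C)
    - single (pair_monomial x (drop (length B) b) C) 1 * cols_det (take (length B) b) B \<in> V"
  using assms
proof (induction C arbitrary: b V rule: rev_induct)
  case Nil
  then show ?case by simp
next
  case (snoc c C)
  let ?l = "length B" and ?N = "length B + length C"
  have sum_in: "sum f A \<in> V" if "\<And>i. i \<in> A \<Longrightarrow> f i \<in> V" for f :: "nat \<Rightarrow> _" and A
    using that snoc.prems(1,2) by (induction A rule: infinite_finite_induct) auto
  have len_b: "length b = Suc ?N" using snoc.prems(4) by simp
  define F where "F i = (- 1) ^ (i + ?N) * X_col c (b ! i) * cols_det (drop_nth i b) (B @ map X_col C)" for i
  define b' where "b' = butlast b"
  have b': "b = b' @ [b ! ?N]" "length b' = ?N" "drop_nth ?N b = b'"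
  proof -
    show "length b' = ?N" "drop_nth ?N b = b'" using len_b by (simp_all add: b'_def butlast_conv_take)
    have "b \<noteq> []" using len_b by auto
    have "b = b' @ [last b]" by (simp only: b'_def append_butlast_last_id[OF \<open>b \<noteq> []\<close>])
    moreover have "last b = b ! ?N" using len_b by (simp add: last_conv_nth[OF \<open>b \<noteq> []\<close>])
    ultimately show "b = b' @ [b ! ?N]" by simp
  qed
  have "cols_det b (B @ map X_col (C @ [c])) = cols_det b ((B @ map X_col C) @ [X_col c])" by simp
  also have "\<dots> = (\<Sum>i<length b. F i)"
    by (subst cols_det_snoc) (use len_b in \<open>simp_all add: F_def\<close>)
  also have "\<dots> = (\<Sum>i<?N. F i) + X_col c (b ! ?N) * cols_det b' (B @ map X_col C)"
    using b'(3) by (simp add: len_b F_def flip: mult_2)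
  finally have expand: "cols_det b (B @ map X_col (C @ [c]))
      = (\<Sum>i<?N. F i) + X_col c (b ! ?N) * cols_det b' (B @ map X_col C)" .
  have length_r: "length r = length C" if "length S = ?l" "mset (S @ r @ [p]) = mset b" for S r p
  proof -
    have "length (S @ r @ [p]) = length b" using that(2) by (metis size_mset)
    then show ?thesis using that(1) len_b by simp
  qed
  define V' where "V' = {p. X_col c (b ! ?N) * p \<in> V}"
  have "cols_det b' (B @ map X_col C)
      - single (pair_monomial x (drop ?l b') C) 1 * cols_det (take ?l b') B \<in> V'"
  proof (rule snoc.IH)
    show "p + q \<in> V'" if "p \<in> V'" "q \<in> V'" for p q
      using that snoc.prems(1,2) by (simp_all add: V'_def distrib_left)
    show "0 \<in> V'" using snoc.prems(1) by (simp add: V'_def)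
    show "length b' = length B + length C" by (rule b')
    have "sorted_wrt (<) (b' @ [b ! ?N])" using snoc.prems(3) b'(1) by simp
    then show "sorted_wrt (<) b'" by (simp add: sorted_wrt_append)
    fix S r d
    assume S: "sorted_wrt (<) S" "length S = length B" "mset (S @ r) = mset b'" "S @ r \<noteq> b'"
    have "mset (S @ r @ [b ! ?N]) = mset (b' @ [b ! ?N])" using S(3) by simp
    then have mset: "mset (S @ r @ [b ! ?N]) = mset b" using b'(1) by simp
    have "S @ (r @ [b ! ?N]) \<noteq> b' @ [b ! ?N]" using S(4) by simp
    then have "S @ (r @ [b ! ?N]) \<noteq> b" using b'(1) by simp
    then have "single (pair_monomial x (r @ [b ! ?N]) (C @ [c])) d * cols_det S B \<in> V"
      using S(1,2) mset by (intro snoc.prems(5)) simp_all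
    then show "single (pair_monomial x r C) d * cols_det S B \<in> V'"
      using column_monomial_mult[OF length_r[OF S(2) mset]] by (simp add: V'_def)
  qed
  then have last: "X_col c (b ! ?N) * cols_det b' (B @ map X_col C)
      - single (pair_monomial x (drop ?l b) (C @ [c])) 1 * cols_det (take ?l b) B \<in> V"
  proof -
    have "take ?l b = take ?l b'" "drop ?l b = drop ?l b' @ [b ! ?N]"
      by (subst b'(1), use b'(2) in simp)+
    then show ?thesis
      using \<open>_ \<in> V'\<close> column_monomial_mult[of "drop ?l b'" C c "b ! ?N" 1 "cols_det (take ?l b') B"] b'(2)
      by (simp add: V'_def right_diff_distrib)
  qed
  have "(\<Sum>i<?N. F i) \<in> V"
  proof (rule sum_in)
    fix i assume "i \<in> {..<?N}"
    then have i: "i < ?N" "i < length b" using len_b by auto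
    have "distinct b" using snoc.prems(3) by (simp add: strict_sorted_iff)
    then have last_neq: "b ! i \<noteq> b ! ?N" using i len_b by (simp add: nth_eq_iff_index_eq)
    define V' where "V' = {p. (- 1) ^ (i + ?N) * X_col c (b ! i) * p \<in> V}"
    have "cols_det (drop_nth i b) (B @ map X_col C) \<in> V'"
    proof (rule cols_det_tail)
      show "p + q \<in> V'" if "p \<in> V'" "q \<in> V'" for p q
        using that snoc.prems(1,2) by (simp_all add: V'_def distrib_left)
      show "0 \<in> V'" using snoc.prems(1) by (simp add: V'_def)
      show "sorted_wrt (<) (drop_nth i b)" using snoc.prems(3) i(2) by (rule sorted_drop_nth)
      show "length (drop_nth i b) = length B + length C" using len_b i by simp
      fix S r d
      assume S: "sorted_wrt (<) S" "length S = length B" "mset (S @ r) = mset (drop_nth i b)"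
      have mset: "mset (S @ r @ [b ! i]) = mset b" using mset_drop_nth[OF i(2)] S(3) by simp
      have "S @ r @ [b ! i] \<noteq> b" using last_neq b'(1) by (metis append_assoc last_snoc)
      then have "single (pair_monomial x (r @ [b ! i]) (C @ [c])) ((- 1) ^ (i + ?N) * d) * cols_det S B \<in> V"
        using S(1,2) mset by (intro snoc.prems(5)) simp_all
      then show "single (pair_monomial x r C) d * cols_det S B \<in> V'"
        unfolding V'_def mem_Collect_eq signed_column_monomial_mult[OF length_r[OF S(2) mset]] .
    qed
    then show "F i \<in> V" by (simp add: V'_def F_def)
  qed
  from snoc.prems(2)[OF this last] show ?case unfolding expand by (simp only: add_diff_eq)
qed

text \<open>The determinant with columns $X_1,\dots,X_{h-1},Z,X_{h+1},\dots,X_{l-1},Z$ vanishes. When its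
  last column is written as $\sum_m y_m X_m$, the terms with $m < l$ have a repeated column,
  except for $m = h$, where an interchange of two columns yields the generator of \<open>b\<close>.\<close>
lemma prefix_relation:
  assumes "length b = l" "1 \<le> h" "h < l" "l \<le> n"
  shows "indet (y h) * gen b
    = (\<Sum>m = l..n. indet (y m) * cols_det b (tilde_cols h @ map X_col ([Suc h..<l] @ [m])))"
proof -
  define D where "D m = cols_det b (tilde_cols h @ map X_col ([Suc h..<l] @ [m]))" for m
  have "(\<Sum>m = 1..n. indet (y m) * D m) = cols_det b ((tilde_cols h @ map X_col [Suc h..<l]) @ [XY_col])"
    using cols_det_last_column_sum[of b "tilde_cols h @ map X_col [Suc h..<l]" X_col "\<lambda>m. indet (y m)" "{1..n}"] assms
    by (simp add: D_def length_tilde_cols XY_col_def[abs_def])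
  also have "\<dots> = 0"
    using cols_det_repeated_column[of b "map X_col [1..<h]" "map X_col [Suc h..<l]" XY_col] assms
    by (simp add: tilde_cols_def)
  finally have total: "(\<Sum>m = 1..n. indet (y m) * D m) = 0" .
  have D_0: "D m = 0" if "1 \<le> m" "m < l" "m \<noteq> h" for m
  proof (cases "m < h")
    case True
    then show ?thesis
      using cols_det_repeated_column[of b "map X_col [1..<m]" "map X_col [Suc m..<h] @ [XY_col] @ map X_col [Suc h..<l]" "X_col m"]
        that assms
      unfolding D_def tilde_cols_def upt_split[OF that(1) True] by simp
  next
    case False
    then have "Suc h \<le> m" using that by simp
    then show ?thesis
      using cols_det_repeated_column[of b "tilde_cols h @ map X_col [Suc h..<m]" "map X_col [Suc m..<l]" "X_col m"]
        that assms
      unfolding D_def upt_split[OF \<open>Suc h \<le> m\<close> that(2)] by (simp add: length_tilde_cols)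
  qed
  have D_h: "D h = - gen b"
  proof -
    have "tilde_cols l = map X_col [1..<h] @ X_col h # map X_col [Suc h..<l] @ [XY_col]"
      unfolding tilde_cols_def upt_split[OF assms(2,3)] by simp
    then show ?thesis
      using cols_det_swap_columns[of b "map X_col [1..<h]" "map X_col [Suc h..<l]" XY_col "X_col h"] assms
      by (simp add: D_def tilde_cols_def gen_def)
  qed
  have "indet (y m) * D m = 0" if "m \<in> {1..n} - insert h {l..n}" for m
    using D_0[of m] that by (cases "m < l") auto
  moreover have "insert h {l..n} \<subseteq> {1..n}" using assms by auto
  ultimately have "(\<Sum>m = 1..n. indet (y m) * D m) = (\<Sum>m\<in>insert h {l..n}. indet (y m) * D m)"
    by (intro sum.mono_neutral_right) blast+
  also have "\<dots> = indet (y h) * D h + (\<Sum>m = l..n. indet (y m) * D m)"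
    using assms by simp
  finally show ?thesis using total D_h by (simp add: D_def add_eq_0_iff2)
qed

text \<open>In the prefix relation every term with $m > l$ is small because of $y_m < y_l$. For $m = l$ the
  expansion gives multiples of generators whose leading monomials pair a rearrangement of \<open>b\<close>
  with $1,\dots,l$; all of them are smaller than the one for \<open>b\<close> itself, which comes from the
  prefix.\<close>
lemma prefix_linked:
  assumes b: "sorted_wrt (<) b" "set b \<subseteq> {1..n}" and h: "k \<le> h" "h < length b"
    and u: "keys u \<subseteq> W"
  shows "linked (u + (single (y h) 1 + lm b)) (take h b) b"
proof -
  define l where "l = length b"
  have l: "h < l" "l \<le> n" "1 \<le> h" "length b = l"
    using h length_le_n[OF b] k_pos by (simp_all add: l_def)
  define m0 where "m0 = single (y h) 1 + lm b"
  define C where "C m = [Suc h..<l] @ [m]" for m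
  define D where "D m = cols_det b (tilde_cols h @ map X_col (C m))" for m
  define t where "t = single (y l) 1 + pair_monomial x (drop h b) (C l)"
  define a where "a = take h b"
  have [simp]: "length a = h" "length (take h b) = h" using l by (simp_all add: a_def)
  have C_l: "[1..<Suc h] @ C l = [1..<Suc l]"
    using upt_split[of 1 h "Suc l"] l upt_Suc[of "Suc h" l] by (simp add: C_def upt_split[of 1 h l] del: upt_Suc) (simp add: upt_split[of 1 h l])
  have "a \<in> T" using b h sorted_wrt_take[OF b(1)] set_take_subset[of h b]
    by (auto simp: in_T_iff a_def)
  have "b \<in> T" using b h by (simp add: in_T_iff)
  have lm_split: "single (y l) 1 + pair_monomial x r (C l) + lm S
      = single (y h) 1 + (single (y l) 1 + pair_monomial x (S @ r) [1..<Suc l])"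
    if "length S = h" for S r
    using that pair_monomial_append[of S "[1..<Suc h]" x r "C l"] unfolding C_l
    by (simp add: lm_def ac_simps del: upt_Suc)
  have t: "t + lm a = m0"
    using lm_split[of a "drop h b"] by (simp add: t_def m0_def lm_def[of b] l(4) a_def del: upt_Suc length_take)
  have less: "single (y m) 1 + pair_monomial x r (C m) + lm S < m0"
    if S: "m \<in> {l..n}" "length S = h" "mset (S @ r) = mset b" "m \<noteq> l \<or> S @ r \<noteq> b" for m S r
  proof (cases "m = l")
    case True
    have "pair_monomial x (S @ r) [1..<Suc l] < pair_monomial x b [1..<Suc l]"
      using that True b(1) l(4) by (intro pair_monomial_less_rows)
        (auto simp: strict_sorted_iff simp del: upt_Suc)
    then show ?thesis unfolding True lm_split[OF S(2)]
      by (simp add: m0_def lm_def l(4) add_strict_left_mono del: upt_Suc)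
  next
    case False
    then have "l < m" using S(1) by simp
    have "length (S @ r) = l" using S(3) l(4) by (metis size_mset)
    then have "pair_monomial x r (C m) + pair_monomial x S [1..<Suc h]
        = pair_monomial x (S @ r) ([1..<Suc h] @ C m)"
      using S(2) by (subst pair_monomial_append) (simp_all add: add.commute)
    moreover have "single (y m) 1 + pair_monomial x r (C m) + lm S
        = single (y h) 1 + (single (y m) 1 + (pair_monomial x r (C m) + pair_monomial x S [1..<Suc h]))"
      using S(2) by (simp add: lm_def ac_simps del: upt_Suc)
    ultimately show ?thesis using y_monomial_less[OF \<open>l < m\<close>]
      by (simp add: m0_def lm_def l(4) add_strict_left_mono del: upt_Suc)
  qed
  have below: "below m0 (indet (y m) * (single (pair_monomial x r (C m)) c * cols_det S (tilde_cols h)))"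
    if m: "m \<in> {l..n}" and S: "sorted_wrt (<) S" "length S = h" "mset (S @ r) = mset b"
      and neq: "m \<noteq> l \<or> S @ r \<noteq> b" for m S r c
  proof -
    have set: "set S \<subseteq> {1..n}" "set r \<subseteq> {1..n}"
      using b(2) mset_eq_setD[OF S(3)] by auto
    have "S \<in> T" using S set h by (simp add: in_T_iff)
    moreover have "keys (single (y m) 1 + pair_monomial x r (C m)) \<subseteq> W"
    proof -
      have "set (C m) \<subseteq> {1..n}" using m l by (auto simp: C_def)
      then have "keys (pair_monomial x r (C m)) \<subseteq> W" using set(2) by (rule keys_pair_monomial_W[rotated])
      moreover have "y m \<in> W" using m l by (simp add: W_def)
      ultimately show ?thesis by (simp add: keys_add_monomial)
    qed
    ultimately have "below m0 (single (single (y m) 1 + pair_monomial x r (C m)) c * gen S)"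
      using less[OF m S(2,3) neq] by (intro below_generator) auto
    then show ?thesis using S(2) by (simp add: gen_def indet_def mult_single flip: mult.assoc)
  qed
  have "below m0 (indet (y m) * D m)" if m: "m \<in> {Suc l..n}" for m
  proof -
    have "D m \<in> {p. below m0 (indet (y m) * p)}"
      unfolding D_def
      by (rule cols_det_tail) (use m b l below in
        \<open>auto simp: below_zero below_add distrib_left length_tilde_cols C_def\<close>)
    then show ?thesis by simp
  qed
  moreover have "below m0 (indet (y l) * D l - single t 1 * gen a)"
  proof -
    have "D l - single (pair_monomial x (drop (length (tilde_cols h)) b) (C l)) 1
        * cols_det (take (length (tilde_cols h)) b) (tilde_cols h) \<in> {p. below m0 (indet (y l) * p)}"
      unfolding D_def
      by (rule cols_det_tail_leading) (use b l below in
        \<open>auto simp: below_zero below_add distrib_left length_tilde_cols C_def\<close>)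
    then show ?thesis
      using l by (simp add: length_tilde_cols a_def gen_def t_def indet_def right_diff_distrib mult_single
          flip: mult.assoc)
  qed
  ultimately have "below m0 ((indet (y l) * D l - single t 1 * gen a) + (\<Sum>m = Suc l..n. indet (y m) * D m))"
    by (intro below_add below_sum) auto
  also have "(indet (y l) * D l - single t 1 * gen a) + (\<Sum>m = Suc l..n. indet (y m) * D m)
      = indet (y h) * gen b - single t 1 * gen a"
  proof -
    have "{l..n} = insert l {Suc l..n}" using l by auto
    then show ?thesis using prefix_relation[OF l(4,3,1,2)] by (simp add: D_def C_def)
  qed
  finally have "below m0 (- (indet (y h) * gen b - single t 1 * gen a))" by (rule below_uminus)
  then show ?thesis
    using t u unfolding m0_def[symmetric] a_def[symmetric]
    by (intro linkedI[of t a m0 "single (y h) 1"]) (simp_all add: indet_def m0_def)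
qed

section \<open>All pairs of generators are linked\<close>

text \<open>An entry in column \<open>i + 1\<close> lying strictly between the rows that \<open>a\<close> uses in columns \<open>i\<close> and
  \<open>i + 1\<close> is strictly between two consecutive factors of the diagonal product of \<open>a\<close>, so it is none
  of these factors, whatever coincidences there are among the variables.\<close>
lemma lookup_pair_monomial_between:
  assumes "\<And>s. s < length a \<Longrightarrow> s < i \<Longrightarrow> a ! s < p" "\<And>s. s < length a \<Longrightarrow> i \<le> s \<Longrightarrow> p < a ! s"
  shows "lookup (pair_monomial x a [1..<Suc (length a)]) (x p (Suc i)) = 0"
proof (rule lookup_pair_monomial_eq_0)
  fix q r assume "(q, r) \<in> set (zip a [1..<Suc (length a)])"
  then obtain s where s: "s < length a" "q = a ! s" "r = Suc s"
    by (auto simp: set_zip simp del: upt_Suc)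
  show "x q r \<noteq> x p (Suc i)"
  proof (cases "s < i")
    case True
    then have "x q r < x p (Suc i)" using assms(1)[of s] s by (intro x_strict) auto
    then show ?thesis by simp
  next
    case False
    then have "x p (Suc i) < x q r" using assms(2)[of s] s by (intro x_strict) auto
    then show ?thesis by simp
  qed
qed

text \<open>Inserting \<open>b ! i\<close> into \<open>a\<close> just before \<open>a ! i\<close> gives an increasing list \<open>c\<close>, to which the
  exchange applies. For this \<open>m\<close> must be divisible by the product of the leading monomial of \<open>a\<close>
  and the new variable: the variable does not divide the former, and it divides \<open>m\<close> since it
  divides the leading monomial of \<open>b\<close>.\<close>
lemma replace_entry_linked:
  assumes ab: "a \<in> T" "b \<in> T" "length a = length b"
    and i: "i < length a" "take i a = take i b" "b ! i < a ! i"
    and m: "keys m \<subseteq> W" "m = t + lm a" "m = s + lm b"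
  shows "a[i := b ! i] \<in> T" "\<exists>t'. m = t' + lm (a[i := b ! i])" "linked m a (a[i := b ! i])"
proof -
  let ?p = "b ! i" and ?l = "length a"
  define c where "c = take i a @ ?p # drop i a"
  have drop_c: "drop_nth (Suc i) c = a[i := ?p]" "drop_nth (Suc i - 1) c = a"
    and nth_c: "c ! Suc i = a ! i" "c ! (Suc i - 1) = ?p"
    using i(1) by (simp_all add: c_def upd_conv_take_nth_drop nth_append)
  have a: "sorted_wrt (<) a" "set a \<subseteq> {1..n}" "k \<le> ?l" using ab by (simp_all add: in_T_iff)
  have b: "sorted_wrt (<) b" "set b \<subseteq> {1..n}" using ab by (simp_all add: in_T_iff)
  have before: "q < ?p" if "q \<in> set (take i a)" for q
  proof -
    have "b = take i b @ ?p # drop (Suc i) b" using i(1) ab(3) by (simp add: id_take_nth_drop)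
    then have "sorted_wrt (<) (take i b @ ?p # drop (Suc i) b)" using b(1) by simp
    then show ?thesis using that i(2) by (auto simp: sorted_wrt_append)
  qed
  have after: "?p < q" if "q \<in> set (drop i a)" for q
  proof -
    have "drop i a = a ! i # drop (Suc i) a" using i(1) by (simp add: Cons_nth_drop_Suc)
    moreover have "sorted_wrt (<) (drop i a)" using a(1) by (rule sorted_wrt_drop)
    ultimately show ?thesis using that i(3) by auto
  qed
  have "sorted_wrt (<) (take i a)" "sorted_wrt (<) (drop i a)"
    using a(1) by (simp_all add: sorted_wrt_take sorted_wrt_drop)
  then have c_sorted: "sorted_wrt (<) c"
    using before after less_trans by (fastforce simp: c_def sorted_wrt_append)
  have "?p \<in> {1..n}" using b(2) i(1) ab(3) by (metis nth_mem subsetD)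
  then have c_set: "set c \<subseteq> {1..n}"
    using a(2) set_take_subset[of i a] set_drop_subset[of i a] by (auto simp: c_def)
  have c_len: "length c = Suc ?l" using i(1) by (simp add: c_def)
  show "a[i := ?p] \<in> T"
    using drop_nth_in_T(1)[OF c_sorted c_set c_len a(3), of "Suc i"] i(1) c_len drop_c by simp
  let ?v = "x ?p (Suc i)"
  have "lookup (pair_monomial x a [1..<Suc ?l]) ?v = 0"
  proof (rule lookup_pair_monomial_between)
    fix s assume "s < ?l" "s < i"
    then have "a ! s \<in> set (take i a)" by (auto simp: in_set_conv_nth intro!: exI[of _ s])
    then show "a ! s < ?p" by (rule before)
  next
    fix s assume "s < ?l" "i \<le> s"
    then have "a ! s \<in> set (drop i a)" by (auto simp: in_set_conv_nth intro!: exI[of _ "s - i"])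
    then show "?p < a ! s" by (rule after)
  qed
  moreover have y_neq: "y h \<noteq> ?v" for h using y_x[of h ?p "Suc i"] by simp
  ultimately have lm_a: "lookup (lm a) ?v = 0"
    by (simp add: lm_def lookup_add lookup_single when_def del: upt_Suc)
  have "(?p, Suc i) \<in> set (zip b [1..<Suc (length b)])"
    using i(1) ab(3) by (auto simp: set_zip simp del: upt_Suc intro!: exI[of _ i])
  then have "?v \<in> keys (pair_monomial x b [1..<Suc (length b)])"
    unfolding keys_pair_monomial by (intro image_eqI[of _ _ "(?p, Suc i)"]) simp_all
  then have lm_b: "1 \<le> lookup (lm b) ?v"
    by (simp add: lm_def lookup_add in_keys_iff del: upt_Suc)
  have "lookup (single ?v 1 + lm a) w \<le> lookup m w" for w
  proof (cases "w = ?v")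
    case True
    then show ?thesis using lm_a lm_b unfolding m(3) by (simp add: lookup_add)
  next
    case False
    then show ?thesis unfolding m(2) by (simp add: lookup_add lookup_single when_def)
  qed
  then have m_eq: "(m - (single ?v 1 + lm a)) + (single ?v 1 + lm a) = m" (is "?u + _ = m")
    by (rule monomial_diff_add)
  have "keys ?u \<subseteq> keys (?u + (single ?v 1 + lm a))" by (auto simp: keys_add_monomial)
  then have "keys ?u \<subseteq> W" using m(1) m_eq by simp
  note exchange = exchange_linked[OF c_sorted c_set c_len a(3), of "Suc i" ?u, unfolded drop_c nth_c,
      OF _ _ \<open>keys ?u \<subseteq> W\<close>]
  have mono: "single (x (a ! i) (Suc i)) 1 + lm (a[i := ?p]) = single ?v 1 + lm a"
    using exchange(2) i(1) by simp
  show "\<exists>t'. m = t' + lm (a[i := ?p])"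
    using m_eq unfolding mono[symmetric] by (metis add.assoc)
  have "linked (?u + (single ?v 1 + lm a)) (a[i := ?p]) a"
    using exchange(1) i(1) unfolding mono by simp
  then show "linked m a (a[i := ?p])" unfolding m_eq by (rule linked_sym)
qed

text \<open>Induction on the number of positions after the common prefix of length \<open>i\<close>.\<close>
lemma linked_same_length:
  assumes "a \<in> T" "b \<in> T" "length a = length b"
    and "keys m \<subseteq> W" "\<exists>t. m = t + lm a" "\<exists>s. m = s + lm b"
  shows "linked m a b"
proof -
  have "linked m a b"
    if "take i a = take i b" "i \<le> length a" "a \<in> T" "b \<in> T" "length a = length b"
      "\<exists>t. m = t + lm a" "\<exists>s. m = s + lm b" for i a b
    using that
  proof (induction "length a - i" arbitrary: i a b)
    case 0
    then have "a = b" by simp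
    then show ?case by (simp add: linked_refl)
  next
    case (Suc d)
    then have i: "i < length a" "i < length b" by auto
    obtain t s where m: "m = t + lm a" "m = s + lm b" using Suc.prems by blast
    note extend = take_Suc_conv_app_nth[OF i(1)] take_Suc_conv_app_nth[OF i(2)]
    have d: "d = length a - Suc i" "d = length b - Suc i" using Suc by simp_all
    consider "a ! i = b ! i" | "b ! i < a ! i" | "a ! i < b ! i" by linarith
    then show ?case
    proof cases
      case 1
      then show ?thesis using Suc.hyps(1)[of a "Suc i" b] Suc.prems i d extend by auto
    next
      case 2
      note step = replace_entry_linked[OF Suc.prems(3-5) i(1) Suc.prems(1) 2 assms(4) m]
      have "take (Suc i) (a[i := b ! i]) = take (Suc i) b"
        using i extend Suc.prems(1) by (simp add: take_Suc_conv_app_nth)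
      then have "linked m (a[i := b ! i]) b"
        using Suc.hyps(1)[of "a[i := b ! i]" "Suc i" b] step Suc.prems i d by auto
      then show ?thesis using step(3) linked_trans by blast
    next
      case 3
      note step = replace_entry_linked[OF Suc.prems(4,3) Suc.prems(5)[symmetric] i(2)
          Suc.prems(1)[symmetric] 3 assms(4) m(2,1)]
      have "take (Suc i) a = take (Suc i) (b[i := a ! i])"
        using i extend Suc.prems(1) by (simp add: take_Suc_conv_app_nth)
      then have "linked m a (b[i := a ! i])"
        using Suc.hyps(1)[of a "Suc i" "b[i := a ! i]"] step Suc.prems i d by auto
      then show ?thesis using step(3) linked_trans linked_sym by blast
    qed
  qed
  from this[of 0 a b] show ?thesis using assms by simp
qed

text \<open>The leading monomial of the prefix of \<open>b\<close> divides \<open>m\<close>, because its \<open>y\<close>-variable is provided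
  by \<open>a\<close> and its \<open>x\<close>-variables by \<open>b\<close>. So the prefix connects \<open>a\<close> with \<open>b\<close>.\<close>
lemma linked_shorter:
  assumes "a \<in> T" "b \<in> T" "length a < length b"
    and m: "keys m \<subseteq> W" "m = t + lm a" "m = s + lm b"
  shows "linked m a b"
proof -
  let ?h = "length a"
  let ?c = "take ?h b"
  have b: "sorted_wrt (<) b" "set b \<subseteq> {1..n}" using assms(2) by (simp_all add: in_T_iff)
  have h: "k \<le> ?h" using assms(1) by (simp add: in_T_iff)
  have len_c: "length ?c = ?h" using assms(3) by simp
  have "?c \<in> T"
    using b h sorted_wrt_take[OF b(1)] set_take_subset[of ?h b] len_c by (auto simp: in_T_iff)
  have y_neq: "y (length b) \<noteq> y ?h" using y_less[OF assms(3)] by simp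
  have "lookup (single (y ?h) 1 + lm b) w \<le> lookup m w" for w
  proof (cases "w = y ?h")
    case True
    have "lookup (lm b) (y ?h) = 0" "1 \<le> lookup (lm a) (y ?h)"
      using y_neq by (simp_all add: lm_def lookup_add lookup_single when_def del: upt_Suc)
    then show ?thesis using True unfolding m(2) by (simp add: lookup_add)
  next
    case False
    then show ?thesis unfolding m(3) by (simp add: lookup_add lookup_single when_def)
  qed
  then have m_eq: "(m - (single (y ?h) 1 + lm b)) + (single (y ?h) 1 + lm b) = m" (is "?u + _ = m")
    by (rule monomial_diff_add)
  have "keys ?u \<subseteq> keys (?u + (single (y ?h) 1 + lm b))" by (auto simp: keys_add_monomial)
  then have "keys ?u \<subseteq> W" using m(1) m_eq by simp
  then have c_b: "linked m ?c b"
    using prefix_linked[OF b h assms(3)] m_eq by metis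
  have "pair_monomial x b [1..<Suc (length b)]
      = pair_monomial x (?c @ drop ?h b) ([1..<Suc ?h] @ [Suc ?h..<Suc (length b)])"
    using assms(3) upt_add_eq_append[of 1 "Suc ?h" "length b - ?h"] by (simp del: upt_Suc)
  also have "\<dots> = pair_monomial x ?c [1..<Suc ?h]
      + pair_monomial x (drop ?h b) [Suc ?h..<Suc (length b)]"
    using len_c by (intro pair_monomial_append) (simp del: upt_Suc)
  finally have "single (y ?h) 1 + lm b
      = (single (y (length b)) 1 + pair_monomial x (drop ?h b) [Suc ?h..<Suc (length b)]) + lm ?c"
    using len_c by (simp add: lm_def ac_simps del: upt_Suc length_take)
  then have "\<exists>t. m = t + lm ?c" using m_eq by (metis add.assoc)
  then have "linked m a ?c"
    using assms(1) \<open>?c \<in> T\<close> len_c m by (intro linked_same_length) auto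
  then show ?thesis using c_b by (rule linked_trans)
qed

lemma linked_all:
  assumes "a \<in> T" "b \<in> T" "keys m \<subseteq> W" "\<exists>t. m = t + lm a" "\<exists>t. m = t + lm b"
  shows "linked m a b"
proof -
  obtain t s where m: "m = t + lm a" "m = s + lm b" using assms(4,5) by blast
  consider "length a = length b" | "length a < length b" | "length b < length a" by linarith
  then show ?thesis
  proof cases
    case 1
    then show ?thesis using assms by (intro linked_same_length)
  next
    case 2
    then show ?thesis using assms m by (intro linked_shorter)
  next
    case 3
    then have "linked m b a" using assms m by (intro linked_shorter)
    then show ?thesis by (rule linked_sym)
  qed
qed

theorem leading_monomial_of_combination:
  assumes "f = (\<Sum>a\<in>T. h a * gen a)" "\<And>a t. a \<in> T \<Longrightarrow> t \<in> keys (h a) \<Longrightarrow> keys t \<subseteq> W" "f \<noteq> 0"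
  shows "\<exists>a\<in>T. \<exists>t. keys t \<subseteq> W \<and> t + lm a \<in> keys f \<and> (\<forall>s\<in>keys f. s \<le> t + lm a)"
  using linked_all assms by (rule leading_monomial_divisible)

end

section \<open>Ideals of a polynomial ring\<close>

lemma carrier_poly_ring:
  "p \<in> carrier (poly_ring V) \<longleftrightarrow> (\<forall>m\<in>keys p. keys m \<subseteq> V)"
  by (simp add: poly_ring_def)

lemma ring_poly_ring: "ring (poly_ring V :: ('v, 'k::comm_ring_1) mpoly ring)"
  using poly_ring_cring by (rule cring.axioms(1))

lemma poly_ring_simps [simp]:
  "p \<otimes>\<^bsub>poly_ring V\<^esub> q = p * q" "p \<oplus>\<^bsub>poly_ring V\<^esub> q = p + q" "\<zero>\<^bsub>poly_ring V\<^esub> = 0"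
  by (simp_all add: poly_ring_def)

lemma poly_ring_closed:
  assumes "p \<in> carrier (poly_ring V)" "q \<in> carrier (poly_ring V)"
  shows "p * q \<in> carrier (poly_ring V)" "p + q \<in> carrier (poly_ring V)"
  using ring.ring_simprules(1,5)[OF ring_poly_ring, of p V q] assms by simp_all

lemma poly_ring_idealI:
  fixes I :: "('v, 'k::comm_ring_1) mpoly set"
  assumes "I \<subseteq> carrier (poly_ring V)" "0 \<in> I"
    and "\<And>p q. p \<in> I \<Longrightarrow> q \<in> I \<Longrightarrow> p + q \<in> I"
    and "\<And>p q. p \<in> carrier (poly_ring V) \<Longrightarrow> q \<in> I \<Longrightarrow> p * q \<in> I"
  shows "ideal I (poly_ring V)"
proof (rule idealI)
  let ?R = "poly_ring V :: ('v, 'k) mpoly ring"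
  show ring: "ring ?R" by (rule ring_poly_ring)
  show "subgroup I (add_monoid ?R)"
  proof (rule subgroup.intro)
    fix p assume p: "p \<in> I"
    have "- 1 \<in> carrier ?R" by (simp add: carrier_poly_ring)
    then have "- p \<in> I" using assms(4)[of "- 1" p] p by simp
    moreover have "inv\<^bsub>add_monoid ?R\<^esub> p = - p"
    proof -
      interpret ring ?R by (rule ring)
      have "- p \<in> carrier ?R" "p \<in> carrier ?R" using calculation p assms(1) by blast+
      then show ?thesis unfolding a_inv_def[symmetric] by (intro minus_equality) simp_all
    qed
    ultimately show "inv\<^bsub>add_monoid ?R\<^esub> p \<in> I" by simp
  qed (use assms in auto)
  show "q \<otimes>\<^bsub>?R\<^esub> p \<in> I" if "p \<in> I" "q \<in> carrier ?R" for p q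
    using assms(4) that by simp
  then show "p \<otimes>\<^bsub>?R\<^esub> q \<in> I" if "p \<in> I" "q \<in> carrier ?R" for p q
    using that by (simp add: mult.commute)
qed

lemma genideal_combination:
  fixes g :: "'i \<Rightarrow> ('v, 'k::comm_ring_1) mpoly"
  assumes "finite A" "g ` A \<subseteq> carrier (poly_ring V)" "p \<in> genideal (poly_ring V) (g ` A)"
  shows "\<exists>h. (\<forall>a\<in>A. h a \<in> carrier (poly_ring V)) \<and> p = (\<Sum>a\<in>A. h a * g a)"
proof -
  let ?C = "carrier (poly_ring V)"
  define I where "I = {p. \<exists>h. (\<forall>a\<in>A. h a \<in> ?C) \<and> p = (\<Sum>a\<in>A. h a * g a)}"
  have sum_closed: "sum f B \<in> ?C" if "\<And>b. b \<in> B \<Longrightarrow> f b \<in> ?C" for f :: "'i \<Rightarrow> ('v, 'k) mpoly" and B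
    using that by (induction B rule: infinite_finite_induct)
      (auto intro: poly_ring_closed simp: carrier_poly_ring[of 0])
  have "ideal I (poly_ring V)"
  proof (rule poly_ring_idealI)
    show "I \<subseteq> ?C" using assms(2) by (auto simp: I_def intro!: sum_closed poly_ring_closed)
    show "0 \<in> I" by (auto simp: I_def carrier_poly_ring[of 0] intro!: exI[of _ "\<lambda>_. 0"])
  next
    fix p q assume "p \<in> I" "q \<in> I"
    then obtain h h' where "\<forall>a\<in>A. h a \<in> ?C" "p = (\<Sum>a\<in>A. h a * g a)"
        "\<forall>a\<in>A. h' a \<in> ?C" "q = (\<Sum>a\<in>A. h' a * g a)" by (auto simp: I_def)
    then have "\<forall>a\<in>A. h a + h' a \<in> ?C" "p + q = (\<Sum>a\<in>A. (h a + h' a) * g a)"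
      by (auto simp: distrib_right sum.distrib intro: poly_ring_closed)
    then show "p + q \<in> I" unfolding I_def mem_Collect_eq by (intro exI[of _ "\<lambda>a. h a + h' a"] conjI)
  next
    fix p q :: "('v, 'k) mpoly" assume "p \<in> ?C" "q \<in> I"
    moreover then obtain h where "\<forall>a\<in>A. h a \<in> ?C" "q = (\<Sum>a\<in>A. h a * g a)" by (auto simp: I_def)
    ultimately have "\<forall>a\<in>A. p * h a \<in> ?C" "p * q = (\<Sum>a\<in>A. (p * h a) * g a)"
      by (auto simp: sum_distrib_left mult.assoc intro: poly_ring_closed)
    then show "p * q \<in> I" unfolding I_def mem_Collect_eq by (intro exI[of _ "\<lambda>a. p * h a"] conjI)
  qed
  moreover have "g ` A \<subseteq> I"
  proof
    fix q assume "q \<in> g ` A"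
    then obtain a where a: "a \<in> A" "q = g a" by blast
    have "(\<Sum>b\<in>A. (if b = a then 1 else 0) * g b) = (\<Sum>b\<in>A. if b = a then g a else 0)"
      by (intro sum.cong) auto
    then have "q = (\<Sum>b\<in>A. (if b = a then 1 else 0) * g b)" using assms(1) a by simp
    moreover have "\<forall>b\<in>A. (if b = a then 1 else 0) \<in> ?C" by (simp add: carrier_poly_ring)
    ultimately show "q \<in> I" unfolding I_def mem_Collect_eq
      by (intro exI[of _ "\<lambda>b. if b = a then 1 else 0"] conjI)
  qed
  ultimately have "genideal (poly_ring V) (g ` A) \<subseteq> I"
    by (rule ring.genideal_minimal[OF ring_poly_ring])
  then show ?thesis using assms(3) by (auto simp: I_def)
qed

lemma monomial_in_monomial_ideal:
  fixes F :: "('v, 'k::comm_ring_1) mpoly set"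
  assumes "\<And>f. f \<in> F \<Longrightarrow> \<exists>s\<in>M. \<exists>c. f = single s c" "F \<subseteq> carrier (poly_ring V)"
    and "single m 1 \<in> genideal (poly_ring V) F"
  shows "\<exists>s\<in>M. \<exists>t. m = t + s"
proof -
  let ?C = "carrier (poly_ring V) :: ('v, 'k) mpoly set"
  define I :: "('v, 'k) mpoly set" where "I = {p \<in> ?C. \<forall>m\<in>keys p. \<exists>s\<in>M. \<exists>t. m = t + s}"
  have "ideal I (poly_ring V)"
  proof (rule poly_ring_idealI)
    show "I \<subseteq> ?C" "0 \<in> I" by (auto simp: I_def carrier_poly_ring)
  next
    fix p q assume "p \<in> I" "q \<in> I"
    then show "p + q \<in> I"
      using Poly_Mapping.keys_add[of p q] by (auto simp: I_def intro: poly_ring_closed)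
  next
    fix p q assume p: "p \<in> ?C" and q: "q \<in> I"
    have "\<exists>s\<in>M. \<exists>t. m = t + s" if m: "m \<in> keys (p * q)" for m
    proof -
      obtain u v where "m = u + v" "v \<in> keys q" using m keys_mult[of p q] by blast
      moreover then obtain s t where "s \<in> M" "v = t + s" using q by (auto simp: I_def)
      ultimately show ?thesis by (metis add.assoc)
    qed
    then show "p * q \<in> I" using p q by (auto simp: I_def intro: poly_ring_closed)
  qed
  moreover have "F \<subseteq> I"
  proof
    fix f assume "f \<in> F"
    then obtain s c where "s \<in> M" "f = single s c" using assms(1) by blast
    then show "f \<in> I" using \<open>f \<in> F\<close> assms(2)
      by (auto simp: I_def split: if_splits intro!: bexI[of _ s] exI[of _ 0])
  qed
  ultimately have "genideal (poly_ring V) F \<subseteq> I"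
    by (rule ring.genideal_minimal[OF ring_poly_ring])
  then show ?thesis using assms(3) by (auto simp: I_def)
qed

lemma lead_monomI:
  fixes p :: "('v::linorder, 'k::comm_ring_1) mpoly"
  assumes "m \<in> keys p" "\<And>s. s \<in> keys p \<Longrightarrow> s \<le> m"
  shows "lead_monom (<) p = m"
  unfolding lead_monom_def
proof (rule the_equality)
  show "m \<in> keys p \<and> (\<forall>m'\<in>keys p. m' \<noteq> m \<longrightarrow> m' < m)" using assms by (auto simp: less_le)
  fix s assume "s \<in> keys p \<and> (\<forall>m'\<in>keys p. m' \<noteq> s \<longrightarrow> m' < s)"
  then show "s = m" using assms by (metis leD)
qed

section \<open>The generators form a Groebner basis\<close>

context variable_matrix_ideal
begin

definition shortest :: "nat list set" where
  "shortest = {a \<in> T. length a = k}"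

abbreviation R :: "('v, 'k) mpoly ring" where
  "R \<equiv> poly_ring W"

lemma gen_in_carrier: "gen ` T \<subseteq> carrier R"
  using keys_gen_W by (auto simp: carrier_poly_ring)

lemma shortest_subset: "shortest \<subseteq> T"
  by (auto simp: shortest_def)

lemma ideal_shortest: "ideal (genideal R (gen ` shortest)) R"
  using gen_in_carrier shortest_subset by (intro ring.genideal_ideal[OF ring_poly_ring]) blast

text \<open>The exchange relation with \<open>j = l\<close> expresses a generator through generators whose tuples are
  shorter by one.\<close>
lemma gen_in_ideal:
  assumes "a \<in> T"
  shows "gen a \<in> genideal R (gen ` shortest)"
  using assms
proof (induction "length a" arbitrary: a rule: less_induct)
  case less
  let ?I = "genideal R (gen ` shortest)"
  interpret I: ideal ?I R by (rule ideal_shortest)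
  show ?case
  proof (cases "length a = k")
    case True
    then have "gen a \<in> gen ` shortest" using less.prems by (simp add: shortest_def)
    then show ?thesis
      using ring.genideal_self[OF ring_poly_ring, of "gen ` shortest" W] gen_in_carrier shortest_subset
      by blast
  next
    case False
    then obtain l where l: "length a = Suc l" "k \<le> l"
      using less.prems by (cases "length a") (auto simp: in_T_iff)
    have a: "sorted_wrt (<) a" "set a \<subseteq> {1..n}" using less.prems by (simp_all add: in_T_iff)
    have "gen a = - (\<Sum>i<Suc l. (- 1) ^ (i + l) * indet (x (a ! i) l) * gen (drop_nth i a))"
      using exchange_relation[OF l(1), of l] l(2) k_pos by (simp del: sum.lessThan_Suc)
    also have "\<dots> = (\<Sum>i<Suc l. single (single (x (a ! i) l) 1) (- ((- 1) ^ (i + l))) * gen (drop_nth i a))"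
    proof -
      have "- ((- 1) ^ e * indet v * p) = single (single v 1) (- ((- 1) ^ e)) * p"
        for e v and p :: "('v, 'k) mpoly"
        by (simp add: indet_def sign_monomial single_uminus)
      then show ?thesis by (simp only: sum_negf[symmetric])
    qed
    also have "\<dots> \<in> ?I"
    proof -
      have summand: "single (single (x (a ! i) l) 1) c * gen (drop_nth i a) \<in> ?I" if i: "i < Suc l" for i c
      proof -
        have "gen (drop_nth i a) \<in> ?I"
          using drop_nth_in_T[OF a l] i l(1) by (intro less.hyps) simp_all
        moreover have "a ! i \<in> {1..n}" using i l(1) a(2) by (metis nth_mem subsetD)
        then have "x (a ! i) l \<in> W" using l length_le_n[OF a] k_pos by (auto simp: W_def)
        then have "single (single (x (a ! i) l) 1) c \<in> carrier R" by (simp add: carrier_poly_ring)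
        ultimately show ?thesis using I.I_l_closed by simp
      qed
      have sum_in: "sum f B \<in> ?I" if "\<And>b. b \<in> B \<Longrightarrow> f b \<in> ?I" for f and B :: "nat set"
        using that additive_subgroup.zero_closed[OF I.additive_subgroup_axioms]
          additive_subgroup.a_closed[OF I.additive_subgroup_axioms]
        by (induction B rule: infinite_finite_induct) auto
      show ?thesis by (intro sum_in summand) simp
    qed
    finally show ?thesis .
  qed
qed

lemma lead_monom_gen:
  assumes "a \<in> T"
  shows "lead_monom (<) (gen a) = lm a"
  by (rule lead_monomI) (use assms lookup_gen_lm keys_gen_le in \<open>auto simp: in_keys_iff\<close>)

lemma lead_coef_gen: "a \<in> T \<Longrightarrow> lead_coef (<) (gen a) = 1"
  by (simp add: lead_coef_def lead_monom_gen lookup_gen_lm)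

lemma gen_nonzero: "a \<in> T \<Longrightarrow> gen a \<noteq> 0"
  using lookup_gen_lm[of a] by auto

lemma lead_terms_gen:
  assumes "A \<subseteq> T"
  shows "lead_terms (<) (gen ` A) = (\<lambda>a. single (lm a) 1) ` A"
proof -
  have "gen ` A - {0} = gen ` A" using assms gen_nonzero by auto
  moreover have "single (lead_monom (<) (gen a)) (lead_coef (<) (gen a)) = single (lm a) 1"
    if "a \<in> A" for a
    using that assms lead_monom_gen lead_coef_gen by auto
  ultimately show ?thesis by (simp add: lead_terms_def image_image)
qed

lemma lead_terms_in_carrier:
  assumes "A \<subseteq> T"
  shows "(\<lambda>a. single (lm a) 1) ` A \<subseteq> carrier R"
  using assms keys_lm_W by (auto simp: carrier_poly_ring)

theorem gen_groebner_basis: "groebner_basis R (<) (genideal R (gen ` shortest)) (gen ` T)"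
proof -
  let ?I = "genideal R (gen ` shortest)" and ?J = "genideal R (lead_terms (<) (gen ` T))"
  have "lead_terms (<) (gen ` T) \<subseteq> carrier R"
    using lead_terms_in_carrier[of T] by (simp add: lead_terms_gen)
  then have J: "ideal ?J R" "lead_terms (<) (gen ` T) \<subseteq> ?J"
    by (intro ring.genideal_ideal ring.genideal_self ring_poly_ring; simp)+
  have lead: "lead_terms (<) ?I \<subseteq> ?J"
  proof
    fix q assume "q \<in> lead_terms (<) ?I"
    then obtain f where f: "f \<in> ?I" "f \<noteq> 0" "q = single (lead_monom (<) f) (lead_coef (<) f)"
      by (auto simp: lead_terms_def)
    have "finite shortest" "gen ` shortest \<subseteq> carrier R"
      using finite_T gen_in_carrier shortest_subset by (auto intro: finite_subset)
    then obtain h where h: "\<And>a. a \<in> shortest \<Longrightarrow> h a \<in> carrier R" "f = (\<Sum>a\<in>shortest. h a * gen a)"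
      using genideal_combination[of shortest gen W f] f(1) by blast
    define h' where "h' a = (if a \<in> shortest then h a else 0)" for a
    have "f = (\<Sum>a\<in>T. h' a * gen a)"
      unfolding h(2) h'_def using finite_T shortest_subset
      by (intro sum.mono_neutral_cong_left) auto
    moreover have "keys t \<subseteq> W" if "t \<in> keys (h' a)" for a t
      using that h(1)[of a] by (auto simp: h'_def carrier_poly_ring split: if_splits)
    ultimately obtain a t where at: "a \<in> T" "keys t \<subseteq> W" "t + lm a \<in> keys f"
        "\<forall>s\<in>keys f. s \<le> t + lm a"
      using leading_monomial_of_combination[of f h'] f(2) by blast
    then have "lead_monom (<) f = t + lm a" by (intro lead_monomI) auto
    then have "q = single t (lead_coef (<) f) * single (lm a) 1" by (simp add: f(3) mult_single)
    moreover have "single (lm a) 1 \<in> ?J" using J(2) at(1) by (auto simp: lead_terms_gen)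
    moreover have "single t (lead_coef (<) f) \<in> carrier R" using at(2) by (simp add: carrier_poly_ring)
    ultimately show "q \<in> ?J" using ideal.I_l_closed[OF J(1)] by simp
  qed
  have G: "gen ` T \<subseteq> ?I" using gen_in_ideal by blast
  have I_carrier: "lead_terms (<) ?I \<subseteq> carrier R"
    using lead ideal.Icarr[OF J(1)] by blast
  have "lead_terms (<) (gen ` T) \<subseteq> lead_terms (<) ?I"
    using G by (auto simp: lead_terms_def)
  also have "\<dots> \<subseteq> genideal R (lead_terms (<) ?I)"
    using I_carrier by (rule ring.genideal_self[OF ring_poly_ring])
  finally have "?J \<subseteq> genideal R (lead_terms (<) ?I)"
    using ring.genideal_ideal[OF ring_poly_ring I_carrier]
    by (intro ring.genideal_minimal[OF ring_poly_ring])
  moreover have "genideal R (lead_terms (<) ?I) \<subseteq> ?J"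
    using J(1) lead by (rule ring.genideal_minimal[OF ring_poly_ring])
  ultimately show ?thesis
    using ideal_shortest finite_T G by (auto simp: groebner_basis_def)
qed

lemma reduced_basisI:
  assumes "\<And>a b m t. \<lbrakk>a \<in> T; b \<in> T; m \<in> keys (gen a); m = t + lm b\<rbrakk> \<Longrightarrow> b = a"
  shows "reduced_groebner_basis R (<) (genideal R (gen ` shortest)) (gen ` T)"
proof -
  have "single m 1 \<notin> genideal R (lead_terms (<) (gen ` T - {gen a}))"
    if a: "a \<in> T" "m \<in> keys (gen a)" for a m
  proof
    define A where "A = {b \<in> T. gen b \<noteq> gen a}"
    have A: "gen ` T - {gen a} = gen ` A" "A \<subseteq> T" by (auto simp: A_def)
    assume "single m 1 \<in> genideal R (lead_terms (<) (gen ` T - {gen a}))"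
    then have "single m 1 \<in> genideal R ((\<lambda>b. single (lm b) 1) ` A)"
      using A by (simp add: lead_terms_gen)
    then have "\<exists>s\<in>lm ` A. \<exists>t. m = t + s"
      using lead_terms_in_carrier[OF A(2)] by (intro monomial_in_monomial_ideal[rotated 2]) auto
    then obtain b t where "b \<in> A" "m = t + lm b" by blast
    then show False using assms[of a b m t] a by (auto simp: A_def)
  qed
  moreover have "0 \<notin> gen ` T" using gen_nonzero by force
  ultimately show ?thesis
    using gen_groebner_basis lead_coef_gen by (auto simp: reduced_groebner_basis_def)
qed

end

section \<open>The generic and the generic symmetric matrix\<close>

text \<open>The variables are ordered by decreasing size, to match the lexicographic order on exponent
  maps, for which smaller variables are more significant.\<close>
instantiation var :: linorder
begin

definition less_var :: "var \<Rightarrow> var \<Rightarrow> bool" where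
  "u < v \<longleftrightarrow> var_gt u v"

definition less_eq_var :: "var \<Rightarrow> var \<Rightarrow> bool" where
  "u \<le> v \<longleftrightarrow> u = v \<or> var_gt u v"

instance
proof
  have trans: "var_gt u w" if "var_gt u v" "var_gt v w" for u v w
    using that by (cases u; cases v; cases w) auto
  have asym: "\<not> var_gt v u" if "var_gt u v" for u v
    using that by (cases u; cases v) auto
  fix u v w :: var
  show "u < v \<longleftrightarrow> u \<le> v \<and> \<not> v \<le> u"
    using asym unfolding less_var_def less_eq_var_def by blast
  show "u \<le> u" by (simp add: less_eq_var_def)
  show "u \<le> v \<Longrightarrow> v \<le> w \<Longrightarrow> u \<le> w" using trans unfolding less_eq_var_def by blast
  show "u \<le> v \<Longrightarrow> v \<le> u \<Longrightarrow> u = v" using asym unfolding less_eq_var_def by blast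
  show "u \<le> v \<or> v \<le> u"
    unfolding less_eq_var_def by (cases u; cases v) auto
qed

end

lemma lex_less_var_gt: "lex_less var_gt = (<)"
  by (intro ext) (simp add: lex_less_def monomial_less_iff less_var_def)

lemma x_var_matrix: "variable_matrix (x_var \<kappa>) Yvar"
proof
  show "x_var \<kappa> p r < x_var \<kappa> p s" if "r < s" for p r s
    using that by (cases \<kappa>) (auto simp: less_var_def min_def max_def)
  show "x_var \<kappa> p r < x_var \<kappa> q r" if "p < q" for p q r
    using that by (cases \<kappa>) (auto simp: less_var_def min_def max_def)
  show "Yvar i < Yvar j" if "i < j" for i j using that by (simp add: less_var_def)
  show "Yvar i < x_var \<kappa> p r" for i p r by (cases \<kappa>) (simp_all add: less_var_def)
qed

definition weight :: "('v \<Rightarrow> nat) \<Rightarrow> ('v \<Rightarrow>\<^sub>0 nat) \<Rightarrow> nat" where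
  "weight w m = (\<Sum>v\<in>keys m. lookup m v * w v)"

lemma weight_add: "weight w (s + t) = weight w s + weight w t"
proof -
  have "weight w u = (\<Sum>v\<in>keys s \<union> keys t. lookup u v * w v)" if "keys u \<subseteq> keys s \<union> keys t" for u
    unfolding weight_def using that by (intro sum.mono_neutral_left) (auto simp: in_keys_iff)
  then show ?thesis
    by (simp add: keys_add_monomial lookup_add distrib_right sum.distrib)
qed

lemma weight_single: "weight w (single v 1) = w v"
  by (simp add: weight_def)

lemma weight_pair_monomial:
  assumes "length b = length c"
  shows "weight w (pair_monomial x b c) = (\<Sum>(p, r)\<leftarrow>zip b c. w (x p r))"
  using assms
  by (induction b c rule: list_induct2) (simp_all add: weight_add weight_single[unfolded One_nat_def], simp add: weight_def)

text \<open>In \<open>index_weight p\<close> the index \<open>p\<close> counts whether it is a row or a column index. Hence the weight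
  of \<open>x_var \<kappa> i j\<close> does not see that the symmetric matrix interchanges the two indices.\<close>
fun x_degree :: "var \<Rightarrow> nat" where
  "x_degree (Yvar _) = 0"
| "x_degree (Xvar _ _) = 1"

fun index_weight :: "nat \<Rightarrow> var \<Rightarrow> nat" where
  "index_weight p (Yvar _) = 0"
| "index_weight p (Xvar i j) = (if i = p then 1 else 0) + (if j = p then 1 else 0)"

lemma x_degree_x_var: "x_degree (x_var \<kappa> i j) = 1"
  by (cases \<kappa>) simp_all

lemma index_weight_x_var:
  "index_weight p (x_var \<kappa> i j) = (if i = p then 1 else 0) + (if j = p then 1 else 0)"
  by (cases \<kappa>) (auto simp: min_def max_def)

lemma weight_x_degree:
  "length b = length c \<Longrightarrow> weight x_degree (pair_monomial (x_var \<kappa>) b c) = length b"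
  unfolding weight_pair_monomial
  by (induction b c rule: list_induct2) (simp_all add: x_degree_x_var)

lemma weight_index:
  "length b = length c \<Longrightarrow> weight (index_weight p) (pair_monomial (x_var \<kappa>) b c)
     = count (mset b) p + count (mset c) p"
  unfolding weight_pair_monomial
  by (induction b c rule: list_induct2) (auto simp: index_weight_x_var)

text \<open>The \<open>y\<close>-variable of the leading monomial of \<open>b\<close> is the only one in \<open>m\<close>, which forces \<open>b\<close> to be at
  least as long as \<open>a\<close>. The \<open>x\<close>-degree of \<open>m\<close> is the length of \<open>a\<close>, so that the lengths agree.
  Then both monomials pair the tuples with the columns $1,\dots,k$ in some order, and the index
  weights bound the entries of \<open>b\<close> by those of \<open>a\<close>.\<close>
lemma divisible_only_by_own_leading_monomial:
  fixes K :: "'k::comm_ring_1 itself" and k n :: nat and \<kappa> :: matrix_kind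
  assumes "1 \<le> k"
    and ab: "a \<in> variable_matrix_ideal.T n k" "b \<in> variable_matrix_ideal.T n k"
    and m: "m \<in> keys (variable_matrix_ideal.gen (x_var \<kappa>) Yvar n a :: (var, 'k) mpoly)"
      "m = t + variable_matrix_ideal.lm (x_var \<kappa>) Yvar b"
  shows "b = a"
proof -
  interpret variable_matrix "x_var \<kappa>" Yvar by (rule x_var_matrix)
  interpret variable_matrix_ideal "x_var \<kappa>" Yvar n k K by unfold_locales (rule assms(1))
  have a: "1 \<le> length a" "sorted_wrt (<) a" and b: "1 \<le> length b" "sorted_wrt (<) b"
    using ab assms(1) by (auto simp: in_T_iff)
  obtain h c where h: "length a \<le> h" "mset c = mset ([1..<length a] @ [h])"
      "m = single (Yvar h) 1 + pair_monomial (x_var \<kappa>) a c"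
    using keys_gen[OF a(1) m(1)] by blast
  have eq: "single (Yvar h) 1 + pair_monomial (x_var \<kappa>) a c
      = t + (single (Yvar (length b)) 1 + pair_monomial (x_var \<kappa>) b [1..<Suc (length b)])"
    using h(3) m(2) by (simp add: lm_def del: upt_Suc) 
  have "length c = length ([1..<length a] @ [h])" using h(2) by (metis size_mset)
  then have len_c: "length a = length c" using a(1) by simp
  have "lookup (single (Yvar h) 1 + pair_monomial (x_var \<kappa>) a c) (Yvar (length b)) \<noteq> 0"
    unfolding eq by (simp add: lookup_add del: upt_Suc)
  then have h_b: "h = length b"
    by (simp add: lookup_add lookup_single when_def split: if_splits)
  have "weight x_degree (single (Yvar h) 1 + pair_monomial (x_var \<kappa>) a c) = length a"
    using weight_single[of x_degree "Yvar h"] weight_x_degree[OF len_c] by (simp add: weight_add)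
  moreover have "weight x_degree (t + (single (Yvar (length b)) 1
      + pair_monomial (x_var \<kappa>) b [1..<Suc (length b)])) = weight x_degree t + length b"
    using weight_single[of x_degree "Yvar (length b)"] weight_x_degree[of b "[1..<Suc (length b)]" \<kappa>]
    by (simp add: weight_add del: upt_Suc)
  ultimately have len: "length b = length a" using eq h_b h(1) by simp
  then have mset_c: "mset c = mset [1..<Suc (length b)]" using h(2) h_b a(1) by simp
  have "count (mset b) p \<le> count (mset a) p" for p
  proof -
    have "weight (index_weight p) (single (Yvar h) 1 + pair_monomial (x_var \<kappa>) a c)
        = count (mset a) p + count (mset c) p"
      using weight_single[of "index_weight p" "Yvar h"] weight_index[OF len_c] by (simp add: weight_add)
    moreover have "weight (index_weight p) (t + (single (Yvar (length b)) 1
        + pair_monomial (x_var \<kappa>) b [1..<Suc (length b)]))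
        = weight (index_weight p) t + (count (mset b) p + count (mset [1..<Suc (length b)]) p)"
      using weight_single[of "index_weight p" "Yvar (length b)"]
        weight_index[of b "[1..<Suc (length b)]" p \<kappa>]
      by (simp add: weight_add del: upt_Suc mset_upt)
    ultimately show ?thesis using eq mset_c by simp
  qed
  then have "mset b \<subseteq># mset a" by (simp add: mset_subset_eqI)
  then have "mset b = mset a" using len by (metis mset_subset_size nat_neq_iff size_mset subset_mset.le_imp_less_or_eq)
  moreover have "sorted a" "sorted b" using a(2) b(2) by (simp_all add: strict_sorted_iff)
  ultimately show ?thesis by (metis properties_for_sort)
qed

lemma X_mat_entry:
  assumes "p \<in> {1..n}" "r \<in> {1..n}"
  shows "X_mat \<kappa> n $$ (p - 1, r - 1) = indet (x_var \<kappa> p r)"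
  using assms by (cases p; cases r) (simp_all add: X_mat_def)

theorem theorem4p1:
  fixes n :: nat and \<kappa> :: matrix_kind
  assumes "n \<ge> 1"
  shows "(\<forall>k\<in>{1..n}. reduced_groebner_basis (R_ring \<kappa> n) (lex_less var_gt)
            (I_tilde \<kappa> n k) (G_set \<kappa> n k :: (var, 'k::field) mpoly set))
       \<and> (I_tilde \<kappa> n 1 :: (var, 'k) mpoly set) = I1_XY \<kappa> n
       \<and> reduced_groebner_basis (R_ring \<kappa> n) (lex_less var_gt)
            (I1_XY \<kappa> n) (G_set \<kappa> n 1 :: (var, 'k) mpoly set)"
proof -
  interpret variable_matrix "x_var \<kappa>" Yvar by (rule x_var_matrix)
  interpret one: variable_matrix_ideal "x_var \<kappa>" Yvar n 1 "TYPE('k)" by unfold_locales simp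
  have W: "poly_ring one.W = (R_ring \<kappa> n :: (var, 'k) mpoly ring)"
  proof -
    have "{Yvar j | j. j \<in> {1..n}} = Yvar ` {1..n}" by blast
    moreover have "{x_var \<kappa> i j | i j. i \<in> {1..n} \<and> j \<in> {1..n}}
        = (\<lambda>(i, j). x_var \<kappa> i j) ` ({1..n} \<times> {1..n})"
      by (simp add: set_eq_iff image_iff Bex_def split_paired_Ex) blast
    ultimately show ?thesis by (simp only: R_ring_def one.W_def)
  qed
  have X_tilde: "X_tilde \<kappa> n a = (one.gen a :: (var, 'k) mpoly)" if a: "a \<in> one.T" for a
  proof -
    have len: "1 \<le> length a" and set_a: "set a \<subseteq> {1..n}" using a unfolding one.in_T_iff by simp_all
    have "X_minor \<kappa> n a m = cols_det a (map one.X_col ([1..<length a] @ [m]))"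
      if m: "m \<in> {length a..n}" for m
    proof -
      let ?c = "[1..<length a] @ [m]"
      have "X_mat \<kappa> n $$ (a ! i - 1, ?c ! j - 1) = (map one.X_col ?c ! j) (a ! i)"
        if "i < length a" "j < length ?c" for i j
      proof -
        have "a ! i \<in> {1..n}" using that(1) set_a by (metis nth_mem subsetD)
        moreover have "set ?c \<subseteq> {1..n}" using m len by auto
        then have "?c ! j \<in> {1..n}" using that(2) by (metis nth_mem subsetD)
        ultimately show ?thesis by (simp only: X_mat_entry nth_map[OF that(2)] one.X_col_def)
      qed
      then have "mat (length a) (length ?c) (\<lambda>(i, j). X_mat \<kappa> n $$ (a ! i - 1, ?c ! j - 1))
          = mat (length a) (length (map one.X_col ?c)) (\<lambda>(i, j). (map one.X_col ?c ! j) (a ! i))"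
        by (intro eq_matI) simp_all
      then show ?thesis unfolding X_minor_def minor_def cols_det_def by simp
    qed
    then show ?thesis unfolding X_tilde_def one.gen_expand[OF len]
      by (intro sum.cong) (simp_all add: mult.commute)
  qed
  have reduced: "reduced_groebner_basis (R_ring \<kappa> n) (lex_less var_gt)
      (I_tilde \<kappa> n k) (G_set \<kappa> n k :: (var, 'k) mpoly set)" if k: "k \<in> {1..n}" for k
  proof -
    interpret variable_matrix_ideal "x_var \<kappa>" Yvar n k "TYPE('k)"
      by unfold_locales (use k in simp)
    have "T \<subseteq> one.T" using k unfolding subset_iff in_T_iff one.in_T_iff by auto
    then have X_tilde': "X_tilde \<kappa> n a = (gen a :: (var, 'k) mpoly)" if "a \<in> T" for a
      using X_tilde that by blast
    have "C_tuples n k = shortest"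
      by (auto simp: C_tuples_def shortest_def in_T_iff)
    then have S: "(S_tilde \<kappa> n k :: (var, 'k) mpoly set) = gen ` shortest"
      using X_tilde' shortest_subset unfolding S_tilde_def by (intro image_cong) auto
    have "(\<Union>i\<in>{k..n}. C_tuples n i) = T"
      using length_le_n by (auto simp: C_tuples_def in_T_iff)
    then have "(G_set \<kappa> n k :: (var, 'k) mpoly set) = X_tilde \<kappa> n ` T"
      unfolding G_set_def S_tilde_def by blast
    also have "\<dots> = gen ` T" using X_tilde' by (intro image_cong) auto
    finally have G: "(G_set \<kappa> n k :: (var, 'k) mpoly set) = gen ` T" .
    show ?thesis unfolding G I_tilde_def S lex_less_var_gt W[symmetric]
      by (rule reduced_basisI) (rule divisible_only_by_own_leading_monomial[of k, OF k_pos])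
  qed
  have "elements_mat (X_mat \<kappa> n * Y_mat n) = one.XY_col ` {1..n}"
  proof -
    have entry: "(X_mat \<kappa> n * Y_mat n) $$ (i, 0) = one.XY_col (Suc i)" if "i < n" for i
    proof -
      have "(X_mat \<kappa> n * Y_mat n) $$ (i, 0)
          = (\<Sum>j = 0..<n. indet (x_var \<kappa> (Suc i) (Suc j)) * indet (Yvar (Suc j)) :: (var, 'k) mpoly)"
        using that by (simp add: X_mat_def Y_mat_def scalar_prod_def)
      also have "\<dots> = one.XY_col (Suc i)"
        unfolding one.XY_col_def one.X_col_def by (rule sum.reindex_bij_witness[of _ "\<lambda>j. j - 1" Suc]) auto
      finally show ?thesis .
    qed
    have "elements_mat (X_mat \<kappa> n * Y_mat n)
        = (\<lambda>i. (X_mat \<kappa> n * Y_mat n) $$ (i, 0) :: (var, 'k) mpoly) ` {..<n}"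
      by (auto simp: elements_mat_def X_mat_def Y_mat_def image_iff)
    also have "\<dots> = one.XY_col ` Suc ` {..<n}" using entry by (simp add: image_image)
    also have "Suc ` {..<n} = {1..n}" by (simp add: lessThan_atLeast0 image_Suc_atLeastLessThan atLeastLessThanSuc_atLeastAtMost)
    finally show ?thesis .
  qed
  moreover have "(S_tilde \<kappa> n 1 :: (var, 'k) mpoly set) = one.XY_col ` {1..n}"
  proof -
    have "C_tuples n 1 = (\<lambda>p. [p]) ` {1..n}"
      by (auto simp: C_tuples_def length_Suc_conv image_iff)
    moreover have "X_tilde \<kappa> n [p] = one.XY_col p" if "p \<in> {1..n}" for p
      using that X_tilde[of "[p]"] unfolding one.in_T_iff one.gen_singleton by simp
    ultimately show ?thesis by (simp add: S_tilde_def image_image)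
  qed
  ultimately have "(I_tilde \<kappa> n 1 :: (var, 'k) mpoly set) = I1_XY \<kappa> n"
    by (simp add: I_tilde_def I1_XY_def)
  then show ?thesis using reduced assms by force
qed

end
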